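(* Let $d,n\ge 1$ be integers and let $X=(X_1,\dots,X_d)$ be a random vector with independent components, where $X_j$ has law $\mu_j$, a Borel probability measure absolutely continuous with respect to Lebesgue measure, with continuous density $\rho_j$ taking strictly positive values on its open support $\Omega_j\subseteq\mathbb R$, and cumulative distribution function $F_j$. Put $\Omega=\Omega_1\times\dots\times\Omega_d$ and $\mu=\mu_1\otimes\dots\otimes\mu_d$. Let $u\subseteq\{1,\dots,d\}$ be nonempty. Let $f:\mathbb R^d\to\mathbb R^n$ belong to the class $\mathcal F$ and let $h\in\mathcal T^{u,d}$ be a function associated with $f$, i.e. for some choice of sign and some $\boldsymbol\alpha\in\mathbb R^n$, $$h(x)=\pm\int_{\Omega_u}\frac{\partial^{|u|}f}{\partial x_u}(x'_u,x_{\sim u})\prod_{j\in u}\frac{F_j(x'_j)-\mathbf 1_{[x'_j\ge x_j]}}{\rho_j(x'_j)}\,d\mu(x'_u)+\boldsymbol\alpha ,$$ and assume that $\frac{\partial^{|u|}h}{\partial x_u}(x)=\frac{\partial^{|u|}f}{\partial x_u}(x)$. Then: (i) $$\mathrm{Var}_\mu(h)\preceq\frac1{2^{|u|}}\int_\Omega\frac{\partial^{|u|}h}{\partial x_u}(x)\,\frac{\partial^{|u|}h^{T}}{\partial x_u}(x)\prod_{k\in u}\frac{F_k(x_k)(1-F_k(x_k))}{[\rho_k(x_k)]^2}\,d\mu(x).$$ (ii) Equality holds in (i) for the function $$h_0(x)=\prod_{j\notin u}\left[\mathbf a_jF_j(x_j)+\mathbf b_j\right]\ \prod_{j\in u}\left[\mathbf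 a_jF_j(x_j)-\frac{\mathbf a_j}{2}\right],$$ where $\mathbf a_j,\mathbf b_j\in\mathbb R^n$.
   Context: $\mathcal F$ is the class of functions $f:\mathbb R^d\to\mathbb R^n$ each of whose components is Borel measurable and differentiable with respect to $x_v$ for every $v\subseteq\{1,\dots,d\}$, with $\mathbb E\|f(X)\|^2<+\infty$, and such that for every $v$ the function $\frac{\partial^{|v|}f}{\partial x_v}$ is measurable with $\mathbb E\|\frac{\partial^{|v|}f}{\partial x_v}(X)\|^2<+\infty$. $\mathcal T^{u,d}$ is the class of all functions $h$ of the displayed form, with $f\in\mathcal F$ and $\boldsymbol\alpha\in\mathbb R^n$. For $v\subseteq\{1,\dots,d\}$: $x_v=(x_j)_{j\in v}$, $x_{\sim v}=(x_j)_{j\notin v}$, $(x'_v,x_{\sim v})$ is the point with coordinates $x'_j$ for $j\in v$ and $x_j$ for $j\notin v$; $\Omega_v=\prod_{j\in v}\Omega_j$, $d\mu(x_v)=\prod_{j\in v}d\mu_j(x_j)$. $\frac{\partial^{|v|}}{\partial x_v}:=\prod_{j\in v}\frac{\partial}{\partial x_j}$ is the cross-partial derivative, applied componentwise; $f$ is "differentiable with respect to $x_v$" if it exists. $\mathbf 1_{[a\ge b]}$ equals $1$ if $a\ge b$, $0$ otherwise. Vectors are columns, $T$ is transpose, $\|\cdot\|$ is the Euclidean norm, $\mathrm{Var}_\mu(g)=\int_\Omega gg^{T}d\mu-\int_\Omega g\,d\mu\int_\Omega g^{T}d\mu$. $\Sigma_1\preceq\Sigma_2$ (Loewner order) means $\Sigma_2-\Sigma_1$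 is positive semi-definite. Products of vectors of $\mathbb R^n$ in $h_0$ are taken componentwise. *)

theory Defs
  imports "HOL-Probability.Probability"
begin

text \<open>
  Points of the d-dimensional space are vectors of type \<open>real ^ 'd\<close>; the linear order on the
  finite index type \<open>'d\<close> plays the role of the order of \<open>{1, \<dots>, d}\<close> and is only used to fix the
  order of differentiation in a cross-partial derivative. The target space is \<open>real ^ 'n\<close>.
\<close>

subsection \<open>Cross-partial derivatives\<close>

definition coord_upd :: "real ^ 'd \<Rightarrow> 'd \<Rightarrow> real \<Rightarrow> real ^ 'd" where
  "coord_upd x j t = (\<chi> i. if i = j then t else x $ i)"

definition partial_deriv ::
    "'d \<Rightarrow> (real ^ 'd \<Rightarrow> real ^ 'n) \<Rightarrow> real ^ 'd \<Rightarrow> real ^ 'n" where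
  "partial_deriv j f x = vector_derivative (\<lambda>t. f (coord_upd x j t)) (at (x $ j))"

text \<open>For a list \<open>[j1, \<dots>, jk]\<close> the derivative with respect to \<open>jk\<close> is taken first.\<close>

definition iter_partial ::
    "'d list \<Rightarrow> (real ^ 'd \<Rightarrow> real ^ 'n) \<Rightarrow> real ^ 'd \<Rightarrow> real ^ 'n" where
  "iter_partial js f = foldr partial_deriv js f"

primrec iter_partial_exists ::
    "(real ^ 'd) set \<Rightarrow> 'd list \<Rightarrow> (real ^ 'd \<Rightarrow> real ^ 'n) \<Rightarrow> bool" where
  "iter_partial_exists S [] f \<longleftrightarrow> True"
| "iter_partial_exists S (j # js) f \<longleftrightarrow>
     iter_partial_exists S js f \<and>
     (\<forall>x\<in>S. (\<lambda>t. iter_partial js f (coord_upd x j t)) differentiable at (x $ j))"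

text \<open>
  No interchange of the order of differentiation is required. Both notions are local: if \<open>S\<close> is an
  open box, \<open>differentiable_wrt S v f\<close> and the values of \<open>cross_partial v f\<close> on \<open>S\<close>
  only depend on the values of \<open>f\<close> on \<open>S\<close>.
\<close>

definition cross_partial ::
    "('d::{finite,linorder}) set \<Rightarrow> (real ^ ('d::{finite,linorder}) \<Rightarrow> real ^ 'n) \<Rightarrow> real ^ ('d::{finite,linorder}) \<Rightarrow> real ^ 'n" where
  "cross_partial v f = iter_partial (sorted_list_of_set v) f"

definition differentiable_wrt ::
    "(real ^ ('d::{finite,linorder})) set \<Rightarrow> ('d::{finite,linorder}) set \<Rightarrow> (real ^ ('d::{finite,linorder}) \<Rightarrow> real ^ 'n) \<Rightarrow> bool" where
  "differentiable_wrt S v f \<longleftrightarrow> iter_partial_exists S (sorted_list_of_set v) f"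

subsection \<open>Matrices\<close>

definition outer :: "real ^ 'n \<Rightarrow> real ^ 'n \<Rightarrow> real ^ 'n ^ 'n" where
  "outer a b = (columnvector a :: real ^ 1 ^ 'n) ** transpose (columnvector b)"

definition psd :: "real ^ 'n ^ 'n \<Rightarrow> bool" where
  "psd A \<longleftrightarrow> transpose A = A \<and> (\<forall>z. 0 \<le> z \<bullet> (A *v z))"

definition loewner_le :: "real ^ 'n ^ 'n \<Rightarrow> real ^ 'n ^ 'n \<Rightarrow> bool" (infix "\<preceq>\<^sub>L" 50) where
  "A \<preceq>\<^sub>L B \<longleftrightarrow> psd (B - A)"

subsection \<open>Product distribution and integral representation\<close>

definition regular_marginal :: "real measure \<Rightarrow> (real \<Rightarrow> real) \<Rightarrow> real set \<Rightarrow> bool" where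
  "regular_marginal M r S \<longleftrightarrow>
     prob_space M \<and> r \<in> borel_measurable borel \<and> M = density lborel (\<lambda>t. ennreal (r t)) \<and>
     open S \<and> continuous_on S r \<and> (\<forall>t\<in>S. 0 < r t) \<and> (\<forall>t. t \<notin> S \<longrightarrow> r t = 0)"

definition box_of :: "('d \<Rightarrow> real set) \<Rightarrow> (real ^ 'd) set" where
  "box_of \<Omega> = {x. \<forall>j. x $ j \<in> \<Omega> j}"

definition prod_law :: "('d::finite \<Rightarrow> real measure) \<Rightarrow> (real ^ 'd) measure" where
  "prod_law \<mu> = distr (PiM UNIV \<mu>) borel (\<lambda>y. \<chi> j. y j)"

definition var_matrix ::
    "(real ^ 'd) measure \<Rightarrow> (real ^ 'd) set \<Rightarrow> (real ^ 'd \<Rightarrow> real ^ 'n) \<Rightarrow> real ^ 'n ^ 'n" where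
  "var_matrix M S g =
     (LINT x:S|M. outer (g x) (g x)) - outer (LINT x:S|M. g x) (LINT x:S|M. g x)"

definition class_F ::
    "'a measure \<Rightarrow> ('a \<Rightarrow> real ^ ('d::{finite,linorder})) \<Rightarrow> (real ^ ('d::{finite,linorder}) \<Rightarrow> real ^ 'n) set" where
  "class_F P X =
     {f. f \<in> borel_measurable borel \<and> integrable P (\<lambda>w. (norm (f (X w)))\<^sup>2) \<and>
         (\<forall>v. differentiable_wrt UNIV v f \<and>
              cross_partial v f \<in> borel_measurable borel \<and>
              integrable P (\<lambda>w. (norm (cross_partial v f (X w)))\<^sup>2))}"

definition replace_coords :: "'d set \<Rightarrow> ('d \<Rightarrow> real) \<Rightarrow> real ^ 'd \<Rightarrow> real ^ 'd" where
  "replace_coords u y x = (\<chi> j. if j \<in> u then y j else x $ j)"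

definition repr_integrand ::
    "(('d::{finite,linorder}) \<Rightarrow> real measure) \<Rightarrow> (('d::{finite,linorder}) \<Rightarrow> real \<Rightarrow> real) \<Rightarrow> ('d::{finite,linorder}) set \<Rightarrow>
     (real ^ ('d::{finite,linorder}) \<Rightarrow> real ^ 'n) \<Rightarrow> real ^ ('d::{finite,linorder}) \<Rightarrow> (('d::{finite,linorder}) \<Rightarrow> real) \<Rightarrow> real ^ 'n" where
  "repr_integrand \<mu> \<rho> u f x y =
     (\<Prod>j\<in>u. (cdf (\<mu> j) (y j) - (if y j \<ge> x $ j then 1 else 0)) / \<rho> j (y j)) *\<^sub>R
     cross_partial u f (replace_coords u y x)"

text \<open>
  A representation is understood at the points of \<open>box_of \<Omega>\<close>, which carries the whole mass of
  the product law; the integral has to exist there. Values of \<open>h\<close> elsewhere are irrelevant.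
\<close>

definition associated ::
    "(('d::{finite,linorder}) \<Rightarrow> real measure) \<Rightarrow> (('d::{finite,linorder}) \<Rightarrow> real \<Rightarrow> real) \<Rightarrow> (('d::{finite,linorder}) \<Rightarrow> real set) \<Rightarrow> ('d::{finite,linorder}) set \<Rightarrow>
     (real ^ ('d::{finite,linorder}) \<Rightarrow> real ^ 'n) \<Rightarrow> (real ^ ('d::{finite,linorder}) \<Rightarrow> real ^ 'n) \<Rightarrow> bool" where
  "associated \<mu> \<rho> \<Omega> u f h \<longleftrightarrow>
     (\<exists>s\<in>{1, - 1}. \<exists>\<alpha>. \<forall>x\<in>box_of \<Omega>.
        set_integrable (PiM u \<mu>) (PiE u \<Omega>) (repr_integrand \<mu> \<rho> u f x) \<and>
        h x = s *\<^sub>R (LINT y:PiE u \<Omega>|PiM u \<mu>. repr_integrand \<mu> \<rho> u f x y) + \<alpha>)"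

definition weight ::
    "('d \<Rightarrow> real measure) \<Rightarrow> ('d \<Rightarrow> real \<Rightarrow> real) \<Rightarrow> 'd set \<Rightarrow> real ^ 'd \<Rightarrow> real" where
  "weight \<mu> \<rho> u x =
     (\<Prod>k\<in>u. cdf (\<mu> k) (x $ k) * (1 - cdf (\<mu> k) (x $ k)) / (\<rho> k (x $ k))\<^sup>2)"

definition deriv_outer ::
    "(('d::{finite,linorder}) \<Rightarrow> real measure) \<Rightarrow> (('d::{finite,linorder}) \<Rightarrow> real \<Rightarrow> real) \<Rightarrow> ('d::{finite,linorder}) set \<Rightarrow>
     (real ^ ('d::{finite,linorder}) \<Rightarrow> real ^ 'n) \<Rightarrow> real ^ ('d::{finite,linorder}) \<Rightarrow> real ^ 'n ^ 'n" where
  "deriv_outer \<mu> \<rho> u h x =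
     weight \<mu> \<rho> u x *\<^sub>R outer (cross_partial u h x) (cross_partial u h x)"

text \<open>The extremal function; products of vectors are componentwise, as in the library.\<close>

definition extremal ::
    "('d::finite \<Rightarrow> real measure) \<Rightarrow> 'd set \<Rightarrow> ('d \<Rightarrow> real ^ 'n) \<Rightarrow> ('d \<Rightarrow> real ^ 'n) \<Rightarrow>
     real ^ 'd \<Rightarrow> real ^ 'n" where
  "extremal \<mu> u a b x =
     (\<Prod>j\<in>- u. cdf (\<mu> j) (x $ j) *\<^sub>R a j + b j) *
     (\<Prod>j\<in>u. cdf (\<mu> j) (x $ j) *\<^sub>R a j - (1 / 2) *\<^sub>R a j)"

end

theory Submission
  imports Defs
begin

text \<open>
  Write \<open>F\<^sub>j\<close> for the distribution function of \<open>\<mu>\<^sub>j\<close>. At fixed coordinates outside \<open>u\<close>, the function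
  \<open>h - \<alpha>\<close> is, up to sign, the image of \<open>g(y) = \<partial>\<^sub>uf(y, x\<^sub>\<sim>\<^sub>u) / \<Prod>\<^sub>j \<rho>\<^sub>j(y\<^sub>j)\<close> under the integral operator with
  kernel \<open>c(x, y) = \<Prod>\<^sub>j (F\<^sub>j(y\<^sub>j) - 1[x\<^sub>j \<le> y\<^sub>j])\<close>, the products running over \<open>j \<in> u\<close>. Seen as functions of the
  random point \<open>x\<close>, the factors of \<open>c\<close> are centred indicators of half lines, and the covariance kernel

    \<open>K(y, y') = \<integral> c(x, y) c(x, y') d\<mu>(x) = \<Prod>\<^sub>j (F\<^sub>j(min y\<^sub>j y'\<^sub>j) - F\<^sub>j(y\<^sub>j) F\<^sub>j(y'\<^sub>j))\<close>

  is nonnegative. Expanding the square and applying \<open>g(y) g(y') \<le> (g(y)\<^sup>2 + g(y')\<^sup>2) / 2\<close> against this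
  symmetric kernel gives

    \<open>\<integral> (\<integral> g(y) c(x, y) d\<mu>(y))\<^sup>2 d\<mu>(x) \<le> \<integral> g(y)\<^sup>2 W(y) d\<mu>(y)\<close>,  where  \<open>W(y) = \<integral> K(y, y') d\<mu>(y')\<close>

  (\<open>integral_operator_bound\<close>). The variable \<open>F\<^sub>j(X\<^sub>j)\<close> is uniform on the unit interval, so that the one
  dimensional integral \<open>\<integral> (min s t - s t) dt = s (1 - s) / 2\<close> yields
  \<open>W(y) = 2\<^sup>-\<^sup>|\<^sup>u\<^sup>| \<Prod>\<^sub>j F\<^sub>j(y\<^sub>j) (1 - F\<^sub>j(y\<^sub>j))\<close> (\<open>integral_cdf_kernel_covariance\<close>). This treats all coordinates of
  \<open>u\<close> at once and already has the right constant; dividing by \<open>\<Prod>\<^sub>j \<rho>\<^sub>j\<^sup>2\<close> produces the weight of the theorem.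

  Integration over the remaining coordinates bounds the second moment of \<open>z \<bullet> (h - \<alpha>)\<close> for every vector
  \<open>z\<close> (\<open>repr_integral_bound\<close>). The variance of \<open>z \<bullet> h\<close> is at most its second moment about any constant,
  which gives the scalar inequality (\<open>variance_bound\<close>). As \<open>z\<close> varies, these scalar inequalities are exactly
  the quadratic forms of the Loewner inequality (\<open>loewner_bound\<close>).

  The arithmetic-geometric mean step is an equality when \<open>\<partial>\<^sub>uh / \<Prod>\<^sub>j \<rho>\<^sub>j\<close> is constant in \<open>x\<^sub>u\<close>, which points to
  functions that are affine in each \<open>F\<^sub>j(x\<^sub>j)\<close>, \<open>j \<in> u\<close>. For the extremal function both sides factor into one
  dimensional integrals. The factors for \<open>j \<notin> u\<close> agree, and each \<open>j \<in> u\<close> contributes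
  \<open>\<integral> (F\<^sub>j - 1/2)\<^sup>2 d\<mu>\<^sub>j = 1/12\<close> on the left and \<open>\<integral> F\<^sub>j (1 - F\<^sub>j) d\<mu>\<^sub>j = 1/6\<close> on the right, whose ratio is the factor \<open>1/2\<close>
  (\<open>extremal_properties\<close>).
\<close>

section \<open>Integral operators with a nonnegative covariance kernel\<close>

text \<open>
  A Schur test with constant test function, applied to the covariance kernel \<open>K\<close> of the family
  \<open>c(\<cdot>, y)\<close>. Boundedness of \<open>g\<close> and \<open>c\<close> makes every interchange of integrals legitimate; in particular
  the sign changes of \<open>c\<close> are harmless.
\<close>

lemma integral_operator_bound_bounded:
  fixes c :: "'a \<Rightarrow> 'b \<Rightarrow> real" and g :: "'b \<Rightarrow> real"
  assumes "prob_space M" and "prob_space N"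
    and [measurable]: "(\<lambda>(x, y). c x y) \<in> borel_measurable (M \<Otimes>\<^sub>M N)"
    and c_le: "\<And>x y. \<bar>c x y\<bar> \<le> 1"
    and [measurable]: "g \<in> borel_measurable N" and g_le: "\<And>y. \<bar>g y\<bar> \<le> B"
    and K_nonneg: "\<And>y y'. y \<in> space N \<Longrightarrow> y' \<in> space N \<Longrightarrow> 0 \<le> (\<integral>x. c x y * c x y' \<partial>M)"
  shows "(\<integral>x. (\<integral>y. g y * c x y \<partial>N)\<^sup>2 \<partial>M)
       \<le> (\<integral>y. (g y)\<^sup>2 * (\<integral>y'. (\<integral>x. c x y * c x y' \<partial>M) \<partial>N) \<partial>N)"
proof -
  interpret M: prob_space M by fact
  interpret N: prob_space N by fact
  interpret NN: pair_prob_space N N ..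
  interpret MNN: pair_prob_space M "N \<Otimes>\<^sub>M N" ..
  define K where "K y y' = (\<integral>x. c x y * c x y' \<partial>M)" for y y'
  have cc_le: "\<bar>c x y * c x y'\<bar> \<le> 1" for x y y'
    using mult_mono[OF c_le[of x y] c_le[of x y']] by (simp add: abs_mult)
  have B: "0 \<le> B" using g_le[of undefined] by linarith
  have gg_le: "\<bar>g y * g y'\<bar> \<le> B * B" for y y'
    using mult_mono[OF g_le[of y] g_le[of y']] B by (simp add: abs_mult)
  have scale_le: "\<bar>a * b\<bar> \<le> B * B" if "\<bar>a\<bar> \<le> B * B" "\<bar>b\<bar> \<le> 1" for a b
    using mult_mono[OF that] B by (simp add: abs_mult)
  have [measurable]: "case_prod K \<in> borel_measurable (N \<Otimes>\<^sub>M N)"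
    unfolding K_def by measurable
  have K_le: "\<bar>K y y'\<bar> \<le> 1" if [measurable]: "y \<in> space N" "y' \<in> space N" for y y'
  proof -
    have "\<bar>K y y'\<bar> \<le> (\<integral>x. \<bar>c x y * c x y'\<bar> \<partial>M)"
      unfolding K_def by (rule integral_abs_bound)
    also have "\<dots> \<le> (\<integral>x. 1 \<partial>M)"
      by (intro integral_mono M.integrable_const_bound[where B=1]) (auto simp: cc_le)
    finally show ?thesis by (simp add: M.prob_space)
  qed
  have int_KK: "integrable (N \<Otimes>\<^sub>M N) (\<lambda>(y, y'). \<phi> y y' * K y y')"
    if "(\<lambda>(y, y'). \<phi> y y') \<in> borel_measurable (N \<Otimes>\<^sub>M N)" "\<And>y y'. \<bar>\<phi> y y'\<bar> \<le> B * B" for \<phi>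
  proof (rule NN.integrable_const_bound[where B="B * B"])
    show "AE p in N \<Otimes>\<^sub>M N. norm (case p of (y, y') \<Rightarrow> \<phi> y y' * K y y') \<le> B * B"
      using that(2) K_le by (intro AE_I2) (auto simp: space_pair_measure scale_le)
  qed (use that(1) in measurable)
  have half_sq_le: "\<bar>(g y)\<^sup>2 / 2\<bar> \<le> B * B" for y
  proof -
    have "(g y)\<^sup>2 \<le> B * B" using gg_le[of y y] by (simp add: power2_eq_square)
    moreover have "0 \<le> (g y)\<^sup>2" by simp
    ultimately show ?thesis unfolding abs_le_iff by linarith
  qed
  have int1: "integrable (N \<Otimes>\<^sub>M N) (\<lambda>(y, y'). (g y)\<^sup>2 / 2 * K y y')"
    by (rule int_KK) (use half_sq_le in auto)
  have int2: "integrable (N \<Otimes>\<^sub>M N) (\<lambda>(y, y'). (g y')\<^sup>2 / 2 * K y y')"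
    by (rule int_KK) (use half_sq_le in auto)
  have gc: "\<bar>g y * c x y\<bar> \<le> B" for x y
    using mult_mono[OF g_le[of y] c_le[of x y]] B by (simp add: abs_mult)
  have "(\<integral>x. (\<integral>y. g y * c x y \<partial>N)\<^sup>2 \<partial>M)
      = (\<integral>x. (\<integral>p. (g (fst p) * g (snd p)) * (c x (fst p) * c x (snd p)) \<partial>(N \<Otimes>\<^sub>M N)) \<partial>M)"
  proof (rule Bochner_Integration.integral_cong[OF refl])
    fix x assume [measurable]: "x \<in> space M"
    have int: "integrable N (\<lambda>y. g y * c x y)"
      by (rule N.integrable_const_bound[where B=B]) (auto simp: gc)
    have "(\<integral>p. (g (fst p) * g (snd p)) * (c x (fst p) * c x (snd p)) \<partial>(N \<Otimes>\<^sub>M N))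
        = (\<integral>y. (\<integral>y'. (g y * g y') * (c x y * c x y') \<partial>N) \<partial>N)"
      by (subst NN.integral_fst'[symmetric])
         (auto intro!: NN.integrable_const_bound[where B="B * B"] AE_I2 scale_le gg_le cc_le)
    also have "\<dots> = (\<integral>y. (g y * c x y) * (\<integral>y'. g y' * c x y' \<partial>N) \<partial>N)"
      by (simp add: ac_simps flip: integral_mult_right_zero)
    also have "\<dots> = (\<integral>y. g y * c x y \<partial>N)\<^sup>2"
      by (simp add: power2_eq_square)
    finally show "(\<integral>y. g y * c x y \<partial>N)\<^sup>2
      = (\<integral>p. (g (fst p) * g (snd p)) * (c x (fst p) * c x (snd p)) \<partial>(N \<Otimes>\<^sub>M N))" by simp
  qed
  also have "\<dots> = (\<integral>p. (\<integral>x. (g (fst p) * g (snd p)) * (c x (fst p) * c x (snd p)) \<partial>M) \<partial>(N \<Otimes>\<^sub>M N))"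
    by (rule MNN.Fubini_integral[symmetric])
       (auto intro!: MNN.integrable_const_bound[where B="B * B"] AE_I2 scale_le gg_le cc_le
             simp: split_beta)
  also have "\<dots> = (\<integral>(y, y'). g y * g y' * K y y' \<partial>(N \<Otimes>\<^sub>M N))"
    by (simp add: K_def split_beta')
  also have "\<dots> \<le> (\<integral>(y, y'). (g y)\<^sup>2 / 2 * K y y' + (g y')\<^sup>2 / 2 * K y y' \<partial>(N \<Otimes>\<^sub>M N))"
  proof (rule integral_mono)
    fix p assume p: "p \<in> space (N \<Otimes>\<^sub>M N)"
    \<comment> \<open>This step loses nothing when \<open>g\<close> is constant.\<close>
    have "g (fst p) * g (snd p) \<le> (g (fst p))\<^sup>2 / 2 + (g (snd p))\<^sup>2 / 2"
      using sum_squares_bound[of "g (fst p)" "g (snd p)"] by simp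
    from mult_right_mono[OF this, of "K (fst p) (snd p)"]
    show "(case p of (y, y') \<Rightarrow> g y * g y' * K y y')
        \<le> (case p of (y, y') \<Rightarrow> (g y)\<^sup>2 / 2 * K y y' + (g y')\<^sup>2 / 2 * K y y')"
      using p K_nonneg[of "fst p" "snd p"]
      by (auto simp: K_def space_pair_measure split_beta algebra_simps)
  next
    show "integrable (N \<Otimes>\<^sub>M N) (\<lambda>(y, y'). g y * g y' * K y y')"
      by (rule int_KK[of "\<lambda>y y'. g y * g y'"]) (use gg_le in auto)
    from Bochner_Integration.integrable_add[OF int1 int2]
    show "integrable (N \<Otimes>\<^sub>M N) (\<lambda>(y, y'). (g y)\<^sup>2 / 2 * K y y' + (g y')\<^sup>2 / 2 * K y y')"
      by (simp add: split_beta')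
  qed
  also have "\<dots> = (\<integral>y. (g y)\<^sup>2 * (\<integral>y'. K y y' \<partial>N) \<partial>N)"
  proof -
    have sym: "K y y' = K y' y" for y y' by (simp add: K_def mult.commute)
    have "(\<integral>(y, y'). (g y')\<^sup>2 / 2 * K y y' \<partial>(N \<Otimes>\<^sub>M N)) = (\<integral>(y, y'). (g y)\<^sup>2 / 2 * K y y' \<partial>(N \<Otimes>\<^sub>M N))"
      by (subst NN.integral_product_swap[symmetric]) (auto simp: sym split_beta)
    then have "(\<integral>(y, y'). (g y)\<^sup>2 / 2 * K y y' + (g y')\<^sup>2 / 2 * K y y' \<partial>(N \<Otimes>\<^sub>M N))
       = 2 * (\<integral>(y, y'). (g y)\<^sup>2 / 2 * K y y' \<partial>(N \<Otimes>\<^sub>M N))"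
      using Bochner_Integration.integral_add[OF int1 int2] by (simp add: split_beta')
    also have "(\<integral>(y, y'). (g y)\<^sup>2 / 2 * K y y' \<partial>(N \<Otimes>\<^sub>M N)) = (\<integral>y. (\<integral>y'. (g y)\<^sup>2 / 2 * K y y' \<partial>N) \<partial>N)"
      using NN.integral_fst'[OF int1] by simp
    finally show ?thesis by simp
  qed
  finally show ?thesis by (simp add: K_def)
qed

text \<open>
  For unbounded \<open>g\<close> the double integral of \<open>g(y) g(y') c(x, y) c(x, y')\<close> need not converge absolutely, so
  the bounded case is applied to truncations of \<open>g\<close>. Their images converge almost everywhere by dominated convergence,
  and Fatou's lemma carries the inequality to the limit, including the case of an infinite right-hand side.
\<close>

lemma integral_operator_bound:
  fixes c :: "'a \<Rightarrow> 'b \<Rightarrow> real" and g :: "'b \<Rightarrow> real"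
  assumes "prob_space M" and "prob_space N"
    and [measurable]: "(\<lambda>(x, y). c x y) \<in> borel_measurable (M \<Otimes>\<^sub>M N)"
    and c_le: "\<And>x y. \<bar>c x y\<bar> \<le> 1"
    and [measurable]: "g \<in> borel_measurable N"
    and K_nonneg: "\<And>y y'. y \<in> space N \<Longrightarrow> y' \<in> space N \<Longrightarrow> 0 \<le> (\<integral>x. c x y * c x y' \<partial>M)"
    and int: "AE x in M. integrable N (\<lambda>y. g y * c x y)"
  shows "(\<integral>\<^sup>+x. ennreal ((\<integral>y. g y * c x y \<partial>N)\<^sup>2) \<partial>M)
       \<le> (\<integral>\<^sup>+y. ennreal ((g y)\<^sup>2 * (\<integral>y'. (\<integral>x. c x y * c x y' \<partial>M) \<partial>N)) \<partial>N)"
proof -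
  interpret M: prob_space M by fact
  interpret N: prob_space N by fact
  define W where "W y = (\<integral>y'. (\<integral>x. c x y * c x y' \<partial>M) \<partial>N)" for y
  define gn where "gn n y = (if \<bar>g y\<bar> \<le> real n then g y else 0)" for n y
  have [measurable]: "gn n \<in> borel_measurable N" for n unfolding gn_def by measurable
  have [measurable]: "W \<in> borel_measurable N" unfolding W_def by measurable
  have W: "0 \<le> W y" if "y \<in> space N" for y
    unfolding W_def using that by (rule Bochner_Integration.integral_nonneg[OF K_nonneg])
  have gn_le: "\<bar>gn n y\<bar> \<le> real n" "\<bar>gn n y\<bar> \<le> \<bar>g y\<bar>" for n y by (auto simp: gn_def)
  have gn_lim: "(\<lambda>n. gn n y) \<longlonglongrightarrow> g y" for y
  proof (rule tendsto_eventually)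
    obtain m where m: "\<bar>g y\<bar> \<le> real m" using real_arch_simple by blast
    show "eventually (\<lambda>n. gn n y = g y) sequentially"
      using eventually_ge_at_top[of m] by eventually_elim (use m in \<open>auto simp: gn_def\<close>)
  qed
  have gn_bound: "(\<integral>\<^sup>+x. ennreal ((\<integral>y. gn n y * c x y \<partial>N)\<^sup>2) \<partial>M)
      \<le> (\<integral>\<^sup>+y. ennreal ((g y)\<^sup>2 * W y) \<partial>N)" for n
  proof -
    have ib: "\<bar>\<integral>y. gn n y * c x y \<partial>N\<bar> \<le> real n" if [measurable]: "x \<in> space M" for x
    proof -
      have b: "\<bar>gn n y * c x y\<bar> \<le> real n" for y
        using mult_mono[OF gn_le(1)[of n y] c_le[of x y]] by (simp add: abs_mult)
      have "\<bar>\<integral>y. gn n y * c x y \<partial>N\<bar> \<le> (\<integral>y. \<bar>gn n y * c x y\<bar> \<partial>N)"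
        by (rule integral_abs_bound)
      also have "\<dots> \<le> (\<integral>y. real n \<partial>N)"
        by (intro integral_mono N.integrable_const_bound[where B="real n"]) (auto simp: b)
      finally show ?thesis by (simp add: N.prob_space)
    qed
    have "(\<integral>\<^sup>+x. ennreal ((\<integral>y. gn n y * c x y \<partial>N)\<^sup>2) \<partial>M) = ennreal (\<integral>x. (\<integral>y. gn n y * c x y \<partial>N)\<^sup>2 \<partial>M)"
    proof (rule nn_integral_eq_integral)
      show "integrable M (\<lambda>x. (\<integral>y. gn n y * c x y \<partial>N)\<^sup>2)"
        by (rule M.integrable_const_bound[where B="(real n)\<^sup>2"])
           (use ib in \<open>auto intro!: AE_I2 simp: abs_le_square_iff[symmetric]\<close>)
    qed auto
    also have "\<dots> \<le> ennreal (\<integral>y. (gn n y)\<^sup>2 * W y \<partial>N)"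
      unfolding W_def
      by (intro ennreal_leI integral_operator_bound_bounded[where B="real n"] assms(1-4) K_nonneg gn_le)
         auto
    also have "\<dots> \<le> (\<integral>\<^sup>+y. ennreal ((gn n y)\<^sup>2 * W y) \<partial>N)"
    proof (cases "integrable N (\<lambda>y. (gn n y)\<^sup>2 * W y)")
      case True
      then show ?thesis
        by (subst nn_integral_eq_integral) (auto simp: W intro!: AE_I2)
    qed (simp add: not_integrable_integral_eq)
    also have "\<dots> \<le> (\<integral>\<^sup>+y. ennreal ((g y)\<^sup>2 * W y) \<partial>N)"
      using gn_le(2) by (intro nn_integral_mono ennreal_leI mult_right_mono W)
        (auto simp: abs_le_square_iff[symmetric])
    finally show ?thesis .
  qed
  have lim: "AE x in M. (\<lambda>n. ennreal ((\<integral>y. gn n y * c x y \<partial>N)\<^sup>2)) \<longlonglongrightarrow> ennreal ((\<integral>y. g y * c x y \<partial>N)\<^sup>2)"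
    using int AE_space
  proof eventually_elim
    case (elim x)
    note [measurable] = elim(2)
    have "(\<lambda>n. \<integral>y. gn n y * c x y \<partial>N) \<longlonglongrightarrow> (\<integral>y. g y * c x y \<partial>N)"
    proof (rule integral_dominated_convergence[where w="\<lambda>y. \<bar>g y * c x y\<bar>"])
      show "integrable N (\<lambda>y. \<bar>g y * c x y\<bar>)" using elim(1) by (rule integrable_abs)
    qed (auto intro!: tendsto_mult gn_lim mult_right_mono gn_le(2) simp: abs_mult)
    then show ?case by (intro tendsto_intros)
  qed
  have "(\<integral>\<^sup>+x. ennreal ((\<integral>y. g y * c x y \<partial>N)\<^sup>2) \<partial>M)
      = (\<integral>\<^sup>+x. liminf (\<lambda>n. ennreal ((\<integral>y. gn n y * c x y \<partial>N)\<^sup>2)) \<partial>M)"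
    by (rule nn_integral_cong_AE)
       (use lim in \<open>rule eventually_mono, intro lim_imp_Liminf[symmetric] sequentially_bot\<close>)
  also have "\<dots> \<le> liminf (\<lambda>n. \<integral>\<^sup>+x. ennreal ((\<integral>y. gn n y * c x y \<partial>N)\<^sup>2) \<partial>M)"
    by (rule nn_integral_liminf) measurable
  also have "\<dots> \<le> liminf (\<lambda>n. \<integral>\<^sup>+y. ennreal ((g y)\<^sup>2 * W y) \<partial>N)"
    by (intro Liminf_mono always_eventually allI gn_bound)
  also have "\<dots> = (\<integral>\<^sup>+y. ennreal ((g y)\<^sup>2 * W y) \<partial>N)"
    by (simp add: Liminf_const)
  finally show ?thesis unfolding W_def .
qed

section \<open>The distribution function of an atomless law\<close>

context real_distribution
begin

lemma borel_measurable_cdf [measurable]: "cdf M \<in> borel_measurable borel"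
  by (rule borel_measurable_mono) (simp add: mono_def cdf_nondecreasing)

lemma abs_cdf_le_1: "\<bar>cdf M x\<bar> \<le> 1"
  using cdf_nonneg[of x] cdf_bounded_prob[of x] by simp

lemma abs_cdf_diff_indicator_le_1: "\<bar>cdf M y - (if x \<le> y then 1 else 0)\<bar> \<le> 1"
  using cdf_nonneg[of y] cdf_bounded_prob[of y] by simp

lemma integrable_bounded:
  fixes f :: "real \<Rightarrow> real"
  assumes [measurable]: "f \<in> borel_measurable borel" and "\<And>x. \<bar>f x\<bar> \<le> B"
  shows "integrable M f"
  using assms by (intro integrable_const_bound[where B=B]) auto

lemma integral_if_le: "(\<integral>x. (if x \<le> y then 1 else 0) \<partial>M) = cdf M y"
proof -
  have "(\<integral>x. (if x \<le> y then 1 else 0::real) \<partial>M) = (\<integral>x. indicator {..y} x \<partial>M)"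
    by (intro Bochner_Integration.integral_cong) (auto simp: indicator_def)
  then show ?thesis by (simp add: cdf_def)
qed

text \<open>
  The one-dimensional covariance kernel: the indicators of \<open>{..y}\<close> and \<open>{..y'}\<close> have means \<open>F(y)\<close> and \<open>F(y')\<close>,
  and their product is the indicator of \<open>{..min y y'}\<close>.
\<close>

lemma covariance_cdf_indicators:
  "(\<integral>x. (cdf M y - (if x \<le> y then 1 else 0)) * (cdf M y' - (if x \<le> y' then 1 else 0)) \<partial>M)
    = cdf M (min y y') - cdf M y * cdf M y'"
proof -
  have "(cdf M y - (if x \<le> y then 1 else 0)) * (cdf M y' - (if x \<le> y' then 1 else 0))
     = cdf M y * cdf M y' - cdf M y * (if x \<le> y' then 1 else 0) - cdf M y' * (if x \<le> y then 1 else 0)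
       + (if x \<le> min y y' then 1 else 0)" for x
    by (auto simp: algebra_simps)
  moreover have "integrable M (\<lambda>x. if x \<le> z then 1 else 0 :: real)" for z
    by (rule integrable_bounded[where B=1]) auto
  ultimately show ?thesis
    by (simp add: integral_if_le prob_space[unfolded space_eq_univ] del: min.bounded_iff)
qed

lemma covariance_cdf_indicators_nonneg: "0 \<le> cdf M (min y y') - cdf M y * cdf M y'"
  using cdf_nonneg[of y] cdf_nonneg[of y'] cdf_bounded_prob[of y] cdf_bounded_prob[of y']
  by (cases "y \<le> y'") (auto simp: min_def mult_left_le mult_left_le_one_le)

context
  assumes no_atom: "\<And>x. measure M {x} = 0"
begin

text \<open>
  Two independent points of law \<open>M\<close> that both fall into \<open>A\<close> are almost surely distinct, and by symmetry either
  order has half of the probability. The cases \<open>A = UNIV\<close> and \<open>A = {..y}\<close> give the first moment of the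
  distribution function and its truncated version.
\<close>

lemma integral_measure_below:
  assumes [measurable]: "A \<in> sets borel"
  shows "(\<integral>x. indicator A x * measure M (A \<inter> {..x}) \<partial>M) = (measure M A)\<^sup>2 / 2"
proof -
  interpret MM: pair_prob_space M M ..
  define I where "I x x' = (indicator A x * indicator A x' * (if x' \<le> x then 1 else 0) :: real)" for x x'
  have [measurable]: "case_prod I \<in> borel_measurable (M \<Otimes>\<^sub>M M)"
    unfolding I_def by measurable
  have int: "integrable (M \<Otimes>\<^sub>M M) (case_prod I)"
    by (rule MM.integrable_const_bound[where B=1]) (auto simp: I_def indicator_def)
  have int': "integrable (M \<Otimes>\<^sub>M M) (\<lambda>(x, x'). I x' x)"
    by (rule MM.integrable_const_bound[where B=1]) (auto simp: I_def indicator_def)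
  have below: "(\<integral>x'. I x x' \<partial>M) = indicator A x * measure M (A \<inter> {..x})" for x
  proof -
    have "(\<integral>x'. I x x' \<partial>M) = (\<integral>x'. indicator A x * indicator (A \<inter> {..x}) x' \<partial>M)"
      by (intro Bochner_Integration.integral_cong) (auto simp: I_def indicator_def)
    then show ?thesis by simp
  qed
  have [measurable]: "I x \<in> borel_measurable borel" "(\<lambda>x'. I x' x) \<in> borel_measurable borel" for x
    unfolding I_def by measurable
  have "(\<integral>x. (\<integral>x'. I x x' \<partial>M) \<partial>M) + (\<integral>x. (\<integral>x'. I x' x \<partial>M) \<partial>M)
      = (\<integral>x. (\<integral>x'. I x x' + I x' x \<partial>M) \<partial>M)"
  proof -
    have "integrable M (I x)" "integrable M (\<lambda>x'. I x' x)" for x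
      by (rule integrable_bounded[where B=1]; auto simp: I_def indicator_def)+
    moreover have "integrable M (\<lambda>x. \<integral>x'. I x x' \<partial>M)" "integrable M (\<lambda>x. \<integral>x'. I x' x \<partial>M)"
      using MM.integrable_fst'[OF int] MM.integrable_fst'[OF int'] by simp_all
    ultimately show ?thesis by simp
  qed
  also have "\<dots> = (\<integral>x. (\<integral>x'. indicator A x * indicator A x' \<partial>M) \<partial>M)"
  proof (rule Bochner_Integration.integral_cong[OF refl], rule integral_cong_AE)
    fix x
    have "AE x' in M. x' \<noteq> x"
      using no_atom[of x] by (intro AE_I[of _ _ "{x}"]) (auto simp: emeasure_eq_measure)
    then show "AE x' in M. I x x' + I x' x = indicator A x * indicator A x'"
      by eventually_elim (auto simp: I_def)
  qed auto
  also have "\<dots> = (measure M A)\<^sup>2"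
    by (simp add: power2_eq_square)
  also have "(\<integral>x. (\<integral>x'. I x' x \<partial>M) \<partial>M) = (\<integral>x. (\<integral>x'. I x x' \<partial>M) \<partial>M)"
    by (rule MM.Fubini_integral[OF int])
  finally show ?thesis by (simp add: below)
qed

lemma integral_cdf: "(\<integral>x. cdf M x \<partial>M) = 1 / 2"
  using integral_measure_below[of UNIV] prob_space[unfolded space_eq_univ] by (simp add: cdf_def)

lemma integral_cdf_below: "(\<integral>x. (if x \<le> y then cdf M x else 0) \<partial>M) = (cdf M y)\<^sup>2 / 2"
proof -
  have "(\<integral>x. (if x \<le> y then cdf M x else 0) \<partial>M)
      = (\<integral>x. indicator {..y} x * measure M ({..y} \<inter> {..x}) \<partial>M)"
    by (intro Bochner_Integration.integral_cong) (auto simp: cdf_def indicator_def Int_absorb1)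
  then show ?thesis using integral_measure_below[of "{..y}"] by (simp add: cdf_def)
qed

lemma integral_if_ge: "(\<integral>y. (if x \<le> y then 1 else 0) \<partial>M) = 1 - cdf M x"
proof -
  have "AE y in M. y \<noteq> x"
    using no_atom[of x] by (intro AE_I[of _ _ "{x}"]) (auto simp: emeasure_eq_measure)
  then have "(\<integral>y. (if x \<le> y then 1 else 0::real) \<partial>M) = (\<integral>y. 1 - (if y \<le> x then 1 else 0) \<partial>M)"
    by (intro integral_cong_AE) (auto elim!: eventually_mono)
  also have "\<dots> = 1 - cdf M x"
    by (subst Bochner_Integration.integral_diff)
       (auto simp: integral_if_le prob_space[unfolded space_eq_univ] intro!: integrable_bounded[where B=1])
  finally show ?thesis .
qed

text \<open>
  The source of the factor \<open>1/2\<close> per coordinate; for the uniform law it is \<open>\<integral> (min s t - s t) dt = s (1 - s) / 2\<close>.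
\<close>

lemma integral_covariance_cdf_indicators:
  "(\<integral>y'. cdf M (min y y') - cdf M y * cdf M y' \<partial>M) = cdf M y * (1 - cdf M y) / 2"
proof -
  have "cdf M (min y y') = (if y' \<le> y then cdf M y' else 0) + cdf M y * (1 - (if y' \<le> y then 1 else 0))" for y'
    by (auto simp: min_def)
  moreover have "integrable M (\<lambda>y'. if y' \<le> y then cdf M y' else 0)"
    by (rule integrable_bounded[where B=1]) (auto simp: abs_cdf_le_1)
  moreover have "integrable M (\<lambda>y'. if y' \<le> y then 1 else 0 :: real)"
    by (rule integrable_bounded[where B=1]) auto
  moreover have "integrable M (cdf M)"
    by (rule integrable_bounded[where B=1]) (auto simp: abs_cdf_le_1)
  ultimately have "(\<integral>y'. cdf M (min y y') - cdf M y * cdf M y' \<partial>M)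
      = (cdf M y)\<^sup>2 / 2 + cdf M y * (1 - cdf M y) - cdf M y * (1 / 2)"
    by (simp only: integral_cdf_below integral_if_le integral_cdf prob_space
          Bochner_Integration.integral_diff Bochner_Integration.integral_add
          Bochner_Integration.integrable_diff Bochner_Integration.integrable_add
          integrable_mult_right integral_mult_right_zero integrable_const lebesgue_integral_const
          simp_thms scaleR_one)
  then show ?thesis
    by (simp add: power2_eq_square field_simps)
qed

text \<open>
  Integrating \<open>F(y)\<^sup>2 / 2 = \<integral>\<^bsub>x \<le> y\<^esub> F(x)\<close> over \<open>y\<close> and exchanging the integrals gives \<open>I / 2 = 1 / 2 - I\<close> for
  \<open>I = \<integral> F\<^sup>2\<close>.
\<close>

lemma integral_cdf_squared: "(\<integral>x. (cdf M x)\<^sup>2 \<partial>M) = 1 / 3"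
proof -
  interpret MM: pair_prob_space M M ..
  have int: "integrable M (cdf M)" "integrable M (\<lambda>x. (cdf M x)\<^sup>2)"
    by (rule integrable_bounded[where B=1]; auto simp: abs_cdf_le_1 power_le_one cdf_nonneg cdf_bounded_prob)+
  have I: "integrable (M \<Otimes>\<^sub>M M) (\<lambda>(x, y). if x \<le> y then cdf M x else 0)"
    by (rule MM.integrable_const_bound[where B=1]) (auto simp: abs_cdf_le_1)
  have "(\<integral>y. (cdf M y)\<^sup>2 / 2 \<partial>M) = (\<integral>y. (\<integral>x. (if x \<le> y then cdf M x else 0) \<partial>M) \<partial>M)"
    by (simp add: integral_cdf_below)
  also have "\<dots> = (\<integral>x. (\<integral>y. (if x \<le> y then cdf M x else 0) \<partial>M) \<partial>M)"
    by (rule MM.Fubini_integral[OF I])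
  also have "\<dots> = (\<integral>x. (\<integral>y. cdf M x * (if x \<le> y then 1 else 0) \<partial>M) \<partial>M)"
    by (intro Bochner_Integration.integral_cong) auto
  also have "\<dots> = (\<integral>x. cdf M x - (cdf M x)\<^sup>2 \<partial>M)"
    by (simp add: integral_if_ge right_diff_distrib power2_eq_square)
  also have "\<dots> = 1 / 2 - (\<integral>x. (cdf M x)\<^sup>2 \<partial>M)"
    using int by (simp add: integral_cdf)
  finally show ?thesis by simp
qed

end
end

section \<open>The tensor product kernel\<close>

text \<open>
  The kernel of the integral representation without the factors \<open>1 / \<rho>\<^sub>j(y\<^sub>j)\<close>: these are attached to the function on
  which the operator acts, which keeps the kernel bounded by \<open>1\<close>.
\<close>

definition cdf_kernel :: "('i \<Rightarrow> real measure) \<Rightarrow> 'i set \<Rightarrow> ('i \<Rightarrow> real) \<Rightarrow> ('i \<Rightarrow> real) \<Rightarrow> real" where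
  "cdf_kernel \<mu> u x y = (\<Prod>j\<in>u. cdf (\<mu> j) (y j) - (if x j \<le> y j then 1 else 0))"

locale atomless_marginals =
  fixes \<mu> :: "'i \<Rightarrow> real measure"
  assumes real_distribution: "\<And>j. real_distribution (\<mu> j)"
    and no_atom: "\<And>j x. measure (\<mu> j) {x} = 0"
begin

lemma prob_space_marginal: "prob_space (\<mu> j)"
  by (rule real_distribution.axioms(1)[OF real_distribution])

sublocale product_prob_space \<mu> UNIV
  by (intro product_prob_spaceI prob_space_marginal)

lemma sets_marginal [measurable_cong]: "sets (\<mu> j) = sets borel"
  using real_distribution[of j] by (simp add: real_distribution_def real_distribution_axioms_def)

lemma borel_measurable_cdf [measurable]: "cdf (\<mu> j) \<in> borel_measurable borel"
  by (rule real_distribution.borel_measurable_cdf[OF real_distribution])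

lemma borel_measurable_cdf_kernel [measurable]:
  "(\<lambda>(x, y). cdf_kernel \<mu> u x y) \<in> borel_measurable (PiM u \<mu> \<Otimes>\<^sub>M PiM u \<mu>)"
  unfolding cdf_kernel_def by measurable

lemma abs_cdf_kernel_le_1: "\<bar>cdf_kernel \<mu> u x y\<bar> \<le> 1"
  unfolding cdf_kernel_def abs_prod
  by (intro prod_le_1 conjI abs_ge_zero
      real_distribution.abs_cdf_diff_indicator_le_1[OF real_distribution])

context
  fixes u :: "'i set"
  assumes finite_u: "finite u"
begin

lemma cdf_kernel_covariance:
  "(\<integral>x. cdf_kernel \<mu> u x y * cdf_kernel \<mu> u x y' \<partial>PiM u \<mu>)
    = (\<Prod>j\<in>u. cdf (\<mu> j) (min (y j) (y' j)) - cdf (\<mu> j) (y j) * cdf (\<mu> j) (y' j))"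
proof -
  let ?k = "\<lambda>j t. (cdf (\<mu> j) (y j) - (if t \<le> y j then 1 else 0)) * (cdf (\<mu> j) (y' j) - (if t \<le> y' j then 1 else 0))"
  have int: "integrable (\<mu> j) (?k j)" for j
  proof -
    interpret real_distribution "\<mu> j" by (rule real_distribution)
    show ?thesis
      by (rule integrable_bounded[where B=1])
        (use mult_mono[OF abs_cdf_diff_indicator_le_1 abs_cdf_diff_indicator_le_1] in \<open>auto simp: abs_mult\<close>)
  qed
  have "(\<integral>x. cdf_kernel \<mu> u x y * cdf_kernel \<mu> u x y' \<partial>PiM u \<mu>) = (\<integral>x. (\<Prod>j\<in>u. ?k j (x j)) \<partial>PiM u \<mu>)"
    by (simp add: cdf_kernel_def prod.distrib)
  also have "\<dots> = (\<Prod>j\<in>u. integral\<^sup>L (\<mu> j) (?k j))"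
    by (rule product_integral_prod[OF finite_u int])
  finally show ?thesis
    by (simp add: real_distribution.covariance_cdf_indicators[OF real_distribution])
qed

lemma integral_cdf_kernel_covariance:
  "(\<integral>y'. (\<integral>x. cdf_kernel \<mu> u x y * cdf_kernel \<mu> u x y' \<partial>PiM u \<mu>) \<partial>PiM u \<mu>)
    = (1 / 2 ^ card u) * (\<Prod>j\<in>u. cdf (\<mu> j) (y j) * (1 - cdf (\<mu> j) (y j)))"
proof -
  let ?k = "\<lambda>j t. cdf (\<mu> j) (min (y j) t) - cdf (\<mu> j) (y j) * cdf (\<mu> j) t"
  have int: "integrable (\<mu> j) (?k j)" for j
  proof -
    interpret real_distribution "\<mu> j" by (rule real_distribution)
    have "?k j t \<le> 1" for t
      using cdf_nonneg[of "y j"] cdf_nonneg[of t] cdf_bounded_prob[of "min (y j) t"]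
      by (smt (verit) mult_nonneg_nonneg)
    then show ?thesis
      using covariance_cdf_indicators_nonneg by (intro integrable_bounded[where B=1]) auto
  qed
  have "(\<integral>y'. (\<integral>x. cdf_kernel \<mu> u x y * cdf_kernel \<mu> u x y' \<partial>PiM u \<mu>) \<partial>PiM u \<mu>)
     = (\<Prod>j\<in>u. integral\<^sup>L (\<mu> j) (?k j))"
    unfolding cdf_kernel_covariance by (rule product_integral_prod[OF finite_u int])
  also have "\<dots> = (\<Prod>j\<in>u. cdf (\<mu> j) (y j) * (1 - cdf (\<mu> j) (y j)) / 2)"
    by (simp add: real_distribution.integral_covariance_cdf_indicators[OF real_distribution no_atom])
  finally show ?thesis by (simp add: prod_dividef)
qed

text \<open>
  The inequality of the theorem at fixed coordinates outside \<open>u\<close>.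
\<close>

lemma cdf_kernel_operator_bound:
  assumes [measurable]: "g \<in> borel_measurable (PiM u \<mu>)"
    and "AE x in PiM u \<mu>. integrable (PiM u \<mu>) (\<lambda>y. g y * cdf_kernel \<mu> u x y)"
  shows "(\<integral>\<^sup>+x. ennreal ((\<integral>y. g y * cdf_kernel \<mu> u x y \<partial>PiM u \<mu>)\<^sup>2) \<partial>PiM u \<mu>)
    \<le> (\<integral>\<^sup>+y. ennreal ((g y)\<^sup>2 * ((1 / 2 ^ card u) * (\<Prod>j\<in>u. cdf (\<mu> j) (y j) * (1 - cdf (\<mu> j) (y j))))) \<partial>PiM u \<mu>)"
proof -
  have K_nonneg: "0 \<le> (\<integral>x. cdf_kernel \<mu> u x y * cdf_kernel \<mu> u x y' \<partial>PiM u \<mu>)" for y y'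
    unfolding cdf_kernel_covariance
    by (intro prod_nonneg real_distribution.covariance_cdf_indicators_nonneg[OF real_distribution])
  show ?thesis
    using integral_operator_bound[of "PiM u \<mu>" "PiM u \<mu>" "cdf_kernel \<mu> u" g,
        OF _ _ _ abs_cdf_kernel_le_1 _ K_nonneg assms(2)]
    by (simp add: integral_cdf_kernel_covariance prob_space_PiM prob_space_marginal)
qed

end
end

section \<open>Products of laws with positive continuous densities\<close>

lemma borel_measurable_vec_nth [measurable]: "(\<lambda>x :: real ^ 'n. x $ i) \<in> borel_measurable borel"
  by (intro borel_measurable_continuous_onI linear_continuous_on bounded_linear_vec_nth)

lemma borel_measurable_vecI:
  fixes f :: "'a \<Rightarrow> real ^ 'n"
  assumes "\<And>i. (\<lambda>x. f x $ i) \<in> borel_measurable M"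
  shows "f \<in> borel_measurable M"
proof (rule iffD2[OF borel_measurable_euclidean_space], rule ballI)
  fix b :: "real ^ 'n" assume "b \<in> Basis"
  then obtain i where "b = axis i 1" by (auto simp: Basis_vec_def)
  then show "(\<lambda>x. f x \<bullet> b) \<in> borel_measurable M"
    using assms[of i] by (simp add: inner_axis)
qed

lemma sets_box_of [measurable]:
  fixes \<Omega> :: "'d::finite \<Rightarrow> real set"
  assumes [measurable]: "\<And>j. \<Omega> j \<in> sets borel"
  shows "box_of \<Omega> \<in> sets borel"
proof -
  have "box_of \<Omega> = (\<Inter>j. (\<lambda>x. x $ j) -` \<Omega> j)" by (auto simp: box_of_def)
  also have "\<dots> \<in> sets borel"
    using measurable_sets[OF borel_measurable_vec_nth assms] by (intro sets.finite_INT) auto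
  finally show ?thesis .
qed

locale regular_marginals =
  fixes \<mu> :: "'d::{finite,linorder} \<Rightarrow> real measure"
    and \<rho> :: "'d \<Rightarrow> real \<Rightarrow> real"
    and \<Omega> :: "'d \<Rightarrow> real set"
  assumes regular: "\<And>j. regular_marginal (\<mu> j) (\<rho> j) (\<Omega> j)"
begin

lemma marginal_eq_density: "\<mu> j = density lborel (\<lambda>t. ennreal (\<rho> j t))"
  and borel_measurable_density [measurable]: "\<rho> j \<in> borel_measurable borel"
  and open_support: "open (\<Omega> j)"
  and continuous_on_density: "continuous_on (\<Omega> j) (\<rho> j)"
  and density_pos: "t \<in> \<Omega> j \<Longrightarrow> 0 < \<rho> j t"
  and density_eq_0: "t \<notin> \<Omega> j \<Longrightarrow> \<rho> j t = 0"
  using regular[of j] by (auto simp: regular_marginal_def)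

lemma sets_support [measurable]: "\<Omega> j \<in> sets borel"
  by (rule borel_open[OF open_support])

sublocale atomless_marginals \<mu>
proof (rule atomless_marginals.intro)
  fix j x
  have "prob_space (\<mu> j)" using regular[of j] unfolding regular_marginal_def by blast
  moreover have "sets (\<mu> j) = sets borel" by (subst marginal_eq_density) simp
  ultimately show "real_distribution (\<mu> j)"
    by (simp add: real_distribution_def real_distribution_axioms_def)
  have "AE t in lborel. ennreal (\<rho> j t) * indicator {x} t = 0"
    using AE_lborel_singleton[of x] by (rule eventually_mono) auto
  then have "emeasure (\<mu> j) {x} = 0"
    unfolding marginal_eq_density by (subst emeasure_density) (auto simp: nn_integral_0_iff_AE)
  then show "measure (\<mu> j) {x} = 0" by (simp add: measure_def)
qed

lemma AE_in_support: "AE t in \<mu> j. t \<in> \<Omega> j"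
proof -
  have "t \<in> \<Omega> j" if "0 < \<rho> j t" for t
    using that density_eq_0[of t j] by (cases "t \<in> \<Omega> j") auto
  then show ?thesis
    unfolding marginal_eq_density by (subst AE_density) auto
qed

lemma AE_in_supports: "AE x in PiM u \<mu>. \<forall>j\<in>u. x j \<in> \<Omega> j"
proof -
  have "AE x in PiM u \<mu>. x j \<in> \<Omega> j" if "j \<in> u" for j
    using AE_PiM_component[of u \<mu> j "\<lambda>t. t \<in> \<Omega> j"] prob_space_marginal that AE_in_support by blast
  then show ?thesis
    by (rule AE_finite_allI[OF finite])
qed

lemma measurable_vec_of_fun [measurable]: "(\<lambda>y. \<chi> j. y j) \<in> PiM UNIV \<mu> \<rightarrow>\<^sub>M borel"
  by (rule borel_measurable_vecI) simp

lemma sets_prod_law [measurable_cong]: "sets (prod_law \<mu>) = sets borel"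
  by (simp add: prod_law_def)

lemma prob_space_prod_law: "prob_space (prod_law \<mu>)"
  unfolding prod_law_def
  by (rule prob_space.prob_space_distr[OF prob_space_PiM]) (auto intro: prob_space_marginal)

lemma AE_in_box: "AE x in prod_law \<mu>. x \<in> box_of \<Omega>"
  unfolding prod_law_def
  by (subst AE_distr_iff) (use AE_in_supports[of UNIV] in \<open>auto simp: box_of_def\<close>)

lemma nn_integral_prod_law:
  assumes [measurable]: "\<phi> \<in> borel_measurable borel"
  shows "(\<integral>\<^sup>+x. \<phi> x \<partial>prod_law \<mu>)
    = (\<integral>\<^sup>+b. (\<integral>\<^sup>+a. \<phi> (\<chi> j. if j \<in> u then a j else b j) \<partial>PiM u \<mu>) \<partial>PiM (- u) \<mu>)"
proof -
  have "(\<integral>\<^sup>+x. \<phi> x \<partial>prod_law \<mu>) = (\<integral>\<^sup>+y. \<phi> (\<chi> j. y j) \<partial>PiM (- u \<union> u) \<mu>)"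
    unfolding prod_law_def by (subst nn_integral_distr) simp_all
  also have "\<dots> = (\<integral>\<^sup>+b. (\<integral>\<^sup>+a. \<phi> (\<chi> j. merge (- u) u (b, a) j) \<partial>PiM u \<mu>) \<partial>PiM (- u) \<mu>)"
    by (rule product_nn_integral_fold) auto
  also have "(\<lambda>(b :: 'd \<Rightarrow> real) a. (\<chi> j. merge (- u) u (b, a) j) :: (real, 'd) vec) = (\<lambda>b a. \<chi> j. if j \<in> u then a j else b j)"
    by (auto simp: fun_eq_iff vec_eq_iff merge_def)
  finally show ?thesis by (simp add: fun_eq_iff)
qed

lemma measurable_replace_coords [measurable]:
  "(\<lambda>(x, y). replace_coords u y x) \<in> borel \<Otimes>\<^sub>M PiM u \<mu> \<rightarrow>\<^sub>M borel"
proof (rule borel_measurable_vecI)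
  fix i show "(\<lambda>p. (case p of (x, y) \<Rightarrow> replace_coords u y x) $ i) \<in> borel_measurable (borel \<Otimes>\<^sub>M PiM u \<mu>)"
    by (cases "i \<in> u") (simp_all add: replace_coords_def split_beta)
qed

lemma sets_PiE_support [measurable]: "PiE u \<Omega> \<in> sets (PiM u \<mu>)"
  by (rule sets_PiM_I_finite) auto

lemma borel_measurable_repr_integrand [measurable]:
  assumes [measurable]: "cross_partial u f \<in> borel_measurable borel"
  shows "(\<lambda>(x, y). repr_integrand \<mu> \<rho> u f x y) \<in> borel_measurable (borel \<Otimes>\<^sub>M PiM u \<mu>)"
  unfolding repr_integrand_def by measurable

lemma borel_measurable_repr_integral [measurable]:
  assumes [measurable]: "cross_partial u f \<in> borel_measurable borel"
  shows "(\<lambda>x. LINT y:PiE u \<Omega>|PiM u \<mu>. repr_integrand \<mu> \<rho> u f x y) \<in> borel_measurable borel"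
proof -
  interpret prob_space "PiM u \<mu>" by (intro prob_space_PiM prob_space_marginal)
  show ?thesis unfolding set_lebesgue_integral_def by measurable
qed

section \<open>The second moment of the integral representation\<close>

text \<open>
  For coordinates \<open>b\<close> outside \<open>u\<close> that lie in the supports, the inner integral over \<open>x\<^sub>u\<close> is an instance of
  \<open>cdf_kernel_operator_bound\<close>. For all other \<open>b\<close> the point is outside the box, and both sides are zero.
\<close>

lemma repr_integral_bound:
  fixes f :: "(real, 'd) vec \<Rightarrow> real ^ 'n"
  assumes f [measurable]: "cross_partial u f \<in> borel_measurable borel"
    and int: "\<And>x. x \<in> box_of \<Omega> \<Longrightarrow> set_integrable (PiM u \<mu>) (PiE u \<Omega>) (repr_integrand \<mu> \<rho> u f x)"
  shows "(\<integral>\<^sup>+x\<in>box_of \<Omega>. ennreal ((z \<bullet> (LINT y:PiE u \<Omega>|PiM u \<mu>. repr_integrand \<mu> \<rho> u f x y))\<^sup>2) \<partial>prod_law \<mu>)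
    \<le> ennreal (1 / 2 ^ card u) *
        (\<integral>\<^sup>+x\<in>box_of \<Omega>. ennreal ((z \<bullet> cross_partial u f x)\<^sup>2 * weight \<mu> \<rho> u x) \<partial>prod_law \<mu>)"
proof -
  let ?N = "PiM u \<mu>"
  let ?r = "\<lambda>x. LINT y:PiE u \<Omega>|?N. repr_integrand \<mu> \<rho> u f x y"
  \<comment> \<open>\<open>v b a\<close> is the point with coordinates \<open>a\<close> on \<open>u\<close> and \<open>b\<close> elsewhere; \<open>g b\<close> is the function to
    which the kernel operator is applied, extended by zero outside the supports.\<close>
  define v :: "('d \<Rightarrow> real) \<Rightarrow> ('d \<Rightarrow> real) \<Rightarrow> (real, 'd) vec"
    where "v b a = (\<chi> j. if j \<in> u then a j else b j)" for a b
  define g where "g b y = indicator (PiE u \<Omega>) y * ((z \<bullet> cross_partial u f (v b y)) / (\<Prod>j\<in>u. \<rho> j (y j)))" for b y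
  have [measurable]: "(\<lambda>x. weight \<mu> \<rho> u x) \<in> borel_measurable borel"
    unfolding weight_def by measurable
  have v_meas [measurable]: "v b \<in> ?N \<rightarrow>\<^sub>M borel" for b
  proof (rule borel_measurable_vecI)
    show "(\<lambda>a. v b a $ i) \<in> borel_measurable ?N" for i
      by (cases "i \<in> u") (simp_all add: v_def)
  qed
  have [measurable]: "g b \<in> borel_measurable ?N" for b
    unfolding g_def by measurable
  have replace_v: "replace_coords u y (v b a) = v b y" for a b y
    by (simp add: replace_coords_def v_def vec_eq_iff)
  have v_in_box: "v b a \<in> box_of \<Omega> \<longleftrightarrow> (\<forall>j\<in>-u. b j \<in> \<Omega> j) \<and> (\<forall>j\<in>u. a j \<in> \<Omega> j)" for a b
    by (auto simp: box_of_def v_def)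
  have pointwise: "z \<bullet> (indicator (PiE u \<Omega>) y *\<^sub>R repr_integrand \<mu> \<rho> u f (v b a) y) = g b y * cdf_kernel \<mu> u a y" for a b y
    unfolding g_def repr_integrand_def replace_v cdf_kernel_def prod_dividef
    by (simp add: v_def)
  have inner_bound: "(\<integral>\<^sup>+a. ennreal ((z \<bullet> ?r (v b a))\<^sup>2) * indicator (box_of \<Omega>) (v b a) \<partial>?N)
      \<le> ennreal (1 / 2 ^ card u) * (\<integral>\<^sup>+a. ennreal ((z \<bullet> cross_partial u f (v b a))\<^sup>2 * weight \<mu> \<rho> u (v b a)) * indicator (box_of \<Omega>) (v b a) \<partial>?N)"
    for b
  proof (cases "\<forall>j\<in>-u. b j \<in> \<Omega> j")
    case True
    have z_r: "integrable ?N (\<lambda>y. g b y * cdf_kernel \<mu> u a y)"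
      "z \<bullet> ?r (v b a) = (\<integral>y. g b y * cdf_kernel \<mu> u a y \<partial>?N)"
      if "\<forall>j\<in>u. a j \<in> \<Omega> j" for a
    proof -
      have "integrable ?N (\<lambda>y. indicator (PiE u \<Omega>) y *\<^sub>R repr_integrand \<mu> \<rho> u f (v b a) y)"
        using int[of "v b a"] v_in_box True that by (auto simp: set_integrable_def)
      then show "integrable ?N (\<lambda>y. g b y * cdf_kernel \<mu> u a y)"
        "z \<bullet> ?r (v b a) = (\<integral>y. g b y * cdf_kernel \<mu> u a y \<partial>?N)"
        unfolding set_lebesgue_integral_def pointwise[symmetric]
        by (auto intro: integrable_inner_right simp del: inner_scaleR_right simp flip: integral_inner_right)
    qed
    have "(\<integral>\<^sup>+a. ennreal ((z \<bullet> ?r (v b a))\<^sup>2) * indicator (box_of \<Omega>) (v b a) \<partial>?N)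
      = (\<integral>\<^sup>+a. ennreal ((\<integral>y. g b y * cdf_kernel \<mu> u a y \<partial>?N)\<^sup>2) \<partial>?N)"
      using AE_in_supports[of u] by (intro nn_integral_cong_AE) (auto simp: v_in_box True z_r elim!: eventually_mono)
    also have "\<dots> \<le> (\<integral>\<^sup>+a. ennreal ((g b a)\<^sup>2 * ((1 / 2 ^ card u) * (\<Prod>j\<in>u. cdf (\<mu> j) (a j) * (1 - cdf (\<mu> j) (a j))))) \<partial>?N)"
      using AE_in_supports[of u] by (intro cdf_kernel_operator_bound) (auto simp: z_r elim!: eventually_mono)
    also have "\<dots> = (\<integral>\<^sup>+a. ennreal (1 / 2 ^ card u) * (ennreal ((z \<bullet> cross_partial u f (v b a))\<^sup>2 * weight \<mu> \<rho> u (v b a)) * indicator (box_of \<Omega>) (v b a)) \<partial>?N)"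
    proof (rule nn_integral_cong)
      fix a assume "a \<in> space ?N"
      then have "a \<in> PiE u \<Omega> \<longleftrightarrow> v b a \<in> box_of \<Omega>"
        using True by (auto simp: v_in_box space_PiM PiE_iff)
      then show "ennreal ((g b a)\<^sup>2 * ((1 / 2 ^ card u) * (\<Prod>j\<in>u. cdf (\<mu> j) (a j) * (1 - cdf (\<mu> j) (a j)))))
        = ennreal (1 / 2 ^ card u) * (ennreal ((z \<bullet> cross_partial u f (v b a))\<^sup>2 * weight \<mu> \<rho> u (v b a)) * indicator (box_of \<Omega>) (v b a))"
        by (auto simp: g_def weight_def v_def indicator_def prod_dividef power_divide prod_power_distrib
            ac_simps simp flip: ennreal_mult')
    qed
    also have "\<dots> = ennreal (1 / 2 ^ card u) * (\<integral>\<^sup>+a. ennreal ((z \<bullet> cross_partial u f (v b a))\<^sup>2 * weight \<mu> \<rho> u (v b a)) * indicator (box_of \<Omega>) (v b a) \<partial>?N)"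
      by (rule nn_integral_cmult) measurable
    finally show ?thesis .
  next
    case False
    then have "v b a \<notin> box_of \<Omega>" for a by (simp add: v_in_box)
    then show ?thesis by simp
  qed
  have v_meas2 [measurable]: "(\<lambda>(b, a). v b a) \<in> PiM (- u) \<mu> \<Otimes>\<^sub>M ?N \<rightarrow>\<^sub>M borel"
  proof (rule borel_measurable_vecI)
    fix i show "(\<lambda>p. (case p of (b, a) \<Rightarrow> v b a) $ i) \<in> borel_measurable (PiM (- u) \<mu> \<Otimes>\<^sub>M ?N)"
      by (cases "i \<in> u") (simp_all add: v_def split_beta)
  qed
  interpret U: prob_space ?N by (intro prob_space_PiM prob_space_marginal)
  have "(\<integral>\<^sup>+x\<in>box_of \<Omega>. ennreal ((z \<bullet> ?r x)\<^sup>2) \<partial>prod_law \<mu>)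
    = (\<integral>\<^sup>+b. (\<integral>\<^sup>+a. ennreal ((z \<bullet> ?r (v b a))\<^sup>2) * indicator (box_of \<Omega>) (v b a) \<partial>?N) \<partial>PiM (- u) \<mu>)"
    unfolding v_def by (rule nn_integral_prod_law) measurable
  also have "\<dots> \<le> (\<integral>\<^sup>+b. ennreal (1 / 2 ^ card u) * (\<integral>\<^sup>+a. ennreal ((z \<bullet> cross_partial u f (v b a))\<^sup>2 * weight \<mu> \<rho> u (v b a)) * indicator (box_of \<Omega>) (v b a) \<partial>?N) \<partial>PiM (- u) \<mu>)"
    by (intro nn_integral_mono inner_bound)
  also have "\<dots> = ennreal (1 / 2 ^ card u) * (\<integral>\<^sup>+b. (\<integral>\<^sup>+a. ennreal ((z \<bullet> cross_partial u f (v b a))\<^sup>2 * weight \<mu> \<rho> u (v b a)) * indicator (box_of \<Omega>) (v b a) \<partial>?N) \<partial>PiM (- u) \<mu>)"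
    by (rule nn_integral_cmult) measurable
  also have "(\<integral>\<^sup>+b. (\<integral>\<^sup>+a. ennreal ((z \<bullet> cross_partial u f (v b a))\<^sup>2 * weight \<mu> \<rho> u (v b a)) * indicator (box_of \<Omega>) (v b a) \<partial>?N) \<partial>PiM (- u) \<mu>)
    = (\<integral>\<^sup>+x\<in>box_of \<Omega>. ennreal ((z \<bullet> cross_partial u f x)\<^sup>2 * weight \<mu> \<rho> u x) \<partial>prod_law \<mu>)"
    unfolding v_def by (rule nn_integral_prod_law[symmetric]) measurable
  finally show ?thesis .
qed

end

section \<open>The extremal function\<close>

lemma prod_component: "(\<Prod>j\<in>A. f j :: real ^ 'n) $ i = (\<Prod>j\<in>A. f j $ i)"
  by (induction A rule: infinite_finite_induct) auto

lemma outer_component: "outer a b $ i $ j = a $ i * b $ j"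
  by (simp add: outer_def matrix_matrix_mult_def columnvector_def transpose_def)

lemma integrable_vecI:
  fixes f :: "'a \<Rightarrow> 'b::euclidean_space ^ 'n"
  assumes "\<And>i. integrable M (\<lambda>x. f x $ i)"
  shows "integrable M f"
proof -
  have "bounded_linear (axis i :: 'b \<Rightarrow> 'b ^ 'n)" for i
    by (rule linear_conv_bounded_linear[THEN iffD1], rule linearI) (auto simp: axis_def vec_eq_iff)
  then have "integrable M (\<lambda>x. axis i (f x $ i))" for i
    using assms by (rule integrable_bounded_linear)
  then have "integrable M (\<lambda>x. \<Sum>i\<in>UNIV. axis i (f x $ i))"
    by (rule Bochner_Integration.integrable_sum)
  moreover have "(\<Sum>i\<in>UNIV. axis i (v $ i)) = v" for v :: "'b ^ 'n"
    by (simp add: vec_eq_iff axis_def)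
  ultimately show ?thesis by simp
qed

lemma integral_component:
  fixes f :: "'a \<Rightarrow> 'b::euclidean_space ^ 'n"
  assumes "integrable M f"
  shows "(\<integral>x. f x \<partial>M) $ i = (\<integral>x. f x $ i \<partial>M)"
  by (rule integral_bounded_linear[OF bounded_linear_vec_nth assms, symmetric])

text \<open>
  A cross-partial derivative of a product of functions of one coordinate each differentiates the factors
  separately. Differentiability of the factors is only available on \<open>\<Omega>\<close>, which suffices because \<open>\<Omega> j\<close> is open:
  moving one coordinate a little stays inside the box, so the induction hypothesis describes the function that
  is differentiated next on a whole neighbourhood. Components of vectors multiply, so the remaining factors act
  as the bounded linear map \<open>(*) C\<close>.
\<close>

lemma iter_partial_prod:
  fixes \<phi> \<phi>' :: "'d::finite \<Rightarrow> real \<Rightarrow> real ^ 'n"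
  assumes "\<And>j. open (\<Omega> j)"
    and "\<And>j t. j \<in> set js \<Longrightarrow> t \<in> \<Omega> j \<Longrightarrow> (\<phi> j has_vector_derivative \<phi>' j t) (at t)"
    and "distinct js"
  shows "iter_partial_exists (box_of \<Omega>) js (\<lambda>x. \<Prod>j\<in>UNIV. \<phi> j (x $ j)) \<and>
    (\<forall>x\<in>box_of \<Omega>. iter_partial js (\<lambda>x. \<Prod>j\<in>UNIV. \<phi> j (x $ j)) x
       = (\<Prod>j\<in>UNIV. (if j \<in> set js then \<phi>' j else \<phi> j) (x $ j)))"
  using assms(2,3)
proof (induction js)
  case Nil
  then show ?case by (simp add: iter_partial_def)
next
  case (Cons j js)
  let ?H = "\<lambda>x. \<Prod>j\<in>UNIV. \<phi> j (x $ j)"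
  let ?\<psi> = "\<lambda>i. if i \<in> set js then \<phi>' i else \<phi> i"
  have IH: "iter_partial_exists (box_of \<Omega>) js ?H"
    "\<And>x. x \<in> box_of \<Omega> \<Longrightarrow> iter_partial js ?H x = (\<Prod>i\<in>UNIV. ?\<psi> i (x $ i))"
    using Cons by auto
  have deriv: "((\<lambda>t. iter_partial js ?H (coord_upd x j t)) has_vector_derivative
      (\<Prod>i\<in>UNIV. (if i \<in> set (j # js) then \<phi>' i else \<phi> i) (x $ i))) (at (x $ j))"
    if x: "x \<in> box_of \<Omega>" for x
  proof -
    define C where "C = (\<Prod>i\<in>UNIV - {j}. ?\<psi> i (x $ i))"
    have xj: "x $ j \<in> \<Omega> j" using x by (simp add: box_of_def)
    have lin: "bounded_linear ((*) C)"
      by (rule linear_conv_bounded_linear[THEN iffD1], rule linearI) (simp_all add: vec_eq_iff algebra_simps)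
    have "((\<lambda>t. C * \<phi> j t) has_vector_derivative C * \<phi>' j (x $ j)) (at (x $ j))"
      by (rule bounded_linear.has_vector_derivative[OF lin Cons.prems(1)]) (simp_all add: xj)
    also have "C * \<phi>' j (x $ j) = (\<Prod>i\<in>UNIV. (if i \<in> set (j # js) then \<phi>' i else \<phi> i) (x $ i))"
      unfolding C_def by (subst prod.remove[of UNIV j]) (auto intro!: arg_cong2[where f="(*)"] prod.cong simp: mult.commute)
    finally have "((\<lambda>t. C * \<phi> j t) has_vector_derivative
      (\<Prod>i\<in>UNIV. (if i \<in> set (j # js) then \<phi>' i else \<phi> i) (x $ i))) (at (x $ j))" .
    then show ?thesis
    proof (rule has_vector_derivative_transform_within_open)
      fix t assume t: "t \<in> \<Omega> j"
      then have "coord_upd x j t \<in> box_of \<Omega>" using x by (simp add: coord_upd_def box_of_def)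
      then have "iter_partial js ?H (coord_upd x j t) = (\<Prod>i\<in>UNIV. ?\<psi> i (coord_upd x j t $ i))"
        by (rule IH)
      also have "\<dots> = ?\<psi> j t * C"
        unfolding C_def by (subst prod.remove[of UNIV j]) (auto simp: coord_upd_def intro!: arg_cong2[where f="(*)"] prod.cong)
      finally show "C * \<phi> j t = iter_partial js ?H (coord_upd x j t)"
        using Cons.prems(2) by (simp add: mult.commute)
    qed (use assms(1) xj in auto)
  qed
  have "iter_partial (j # js) ?H x = (\<Prod>i\<in>UNIV. (if i \<in> set (j # js) then \<phi>' i else \<phi> i) (x $ i))"
    if "x \<in> box_of \<Omega>" for x
    using vector_derivative_at[OF deriv[OF that]] by (simp add: iter_partial_def partial_deriv_def)
  moreover have "(\<lambda>t. iter_partial js ?H (coord_upd x j t)) differentiable at (x $ j)" if "x \<in> box_of \<Omega>" for x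
    using deriv[OF that] by (rule differentiableI_vector)
  ultimately show ?case using IH(1) by simp
qed

context regular_marginals
begin

text \<open>
  The density is only continuous on the open support, so the fundamental theorem of calculus is applied on a
  small interval around \<open>t\<close>.
\<close>

lemma cdf_has_vector_derivative:
  assumes "t \<in> \<Omega> j"
  shows "(cdf (\<mu> j) has_vector_derivative \<rho> j t) (at t)"
proof -
  interpret R: real_distribution "\<mu> j" by (rule real_distribution)
  obtain e where e: "0 < e" "cball t e \<subseteq> \<Omega> j"
    using open_support assms open_contains_cball by blast
  \<comment> \<open>The antiderivative lives on the interval of radius \<open>e\<close>; half of that radius leaves room for
    two-sided derivatives at the endpoints \<open>a\<close> and \<open>b\<close>.\<close>
  define a b where "a = t - e / 2" and "b = t + e / 2"
  have ab: "a < t" "t < b" using e by (auto simp: a_def b_def)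
  have sub: "{t - e..t + e} \<subseteq> \<Omega> j"
    using e by (simp add: cball_eq_atLeastAtMost)
  obtain G where G0: "\<And>x. x \<in> {t - e..t + e} \<Longrightarrow> (G has_vector_derivative \<rho> j x) (at x within {t - e..t + e})"
    using antiderivative_continuous[OF continuous_on_subset[OF continuous_on_density sub]] by blast
  have "(G has_vector_derivative \<rho> j x) (at x)" if "x \<in> {a..b}" for x
  proof -
    have "t - e < x" "x < t + e" using that e by (auto simp: a_def b_def)
    then show ?thesis using G0[of x] by (simp add: at_within_Icc_at)
  qed
  then have G: "(G has_real_derivative \<rho> j x) (at x)" if "x \<in> {a..b}" for x
    using that by (simp add: has_real_derivative_iff_has_vector_derivative)
  have G_eq: "cdf (\<mu> j) s = cdf (\<mu> j) a + (G s - G a)" if s: "s \<in> {a<..<b}" for s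
  proof -
    have pos: "0 \<le> \<rho> j x" for x
      using density_pos[of x j] density_eq_0[of x j] by (cases "x \<in> \<Omega> j") auto
    have "emeasure (\<mu> j) {a..s} = (\<integral>\<^sup>+x. ennreal (\<rho> j x) * indicator {a..s} x \<partial>lborel)"
      by (subst marginal_eq_density) (simp add: emeasure_density)
    also have "\<dots> = ennreal (G s - G a)"
      by (rule nn_integral_FTC_Icc) (use G pos s in auto)
    finally have em: "emeasure (\<mu> j) {a..s} = ennreal (G s - G a)" .
    have "(\<integral>x. \<rho> j x * indicator {a..s} x \<partial>lborel) = G s - G a"
      by (rule integral_FTC_Icc_nonneg) (use G pos s in auto)
    moreover have "0 \<le> (\<integral>x. \<rho> j x * indicator {a..s} x \<partial>lborel)"
      using pos by (intro Bochner_Integration.integral_nonneg) (simp add: indicator_def)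
    ultimately have "G a \<le> G s" by simp
    have "cdf (\<mu> j) s - cdf (\<mu> j) a = measure (\<mu> j) {a<..s}"
      using s by (intro R.cdf_diff_eq) simp
    also have "\<dots> = measure (\<mu> j) {a..s}"
    proof -
      have "{a..s} = {a} \<union> {a<..s}" using s by auto
      then have "measure (\<mu> j) {a..s} = measure (\<mu> j) {a} + measure (\<mu> j) {a<..s}"
        using finite_measure.finite_measure_Union[OF prob_space.finite_measure[OF prob_space_marginal[of j]], of "{a}" "{a<..s}"] by simp
      then show ?thesis by (simp add: no_atom)
    qed
    also have "\<dots> = G s - G a"
      using em \<open>G a \<le> G s\<close> by (simp add: measure_def)
    finally show ?thesis by simp
  qed
  have "(G has_vector_derivative \<rho> j t) (at t)"
    using G[of t] ab by (simp add: has_real_derivative_iff_has_vector_derivative)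
  then have "((\<lambda>s. cdf (\<mu> j) a + (G s - G a)) has_vector_derivative \<rho> j t) (at t)"
    by (auto intro!: derivative_eq_intros)
  then show ?thesis
    by (rule has_vector_derivative_transform_within_open[where S="{a<..<b}"]) (use G_eq ab in auto)
qed

lemma
  assumes "\<And>j. integrable (\<mu> j) (v j)"
  shows integrable_prod_law_prod: "integrable (prod_law \<mu>) (\<lambda>x. \<Prod>j\<in>UNIV. v j (x $ j) :: real)"
    and integral_prod_law_prod: "(\<integral>x. (\<Prod>j\<in>UNIV. v j (x $ j)) \<partial>prod_law \<mu>) = (\<Prod>j\<in>UNIV. integral\<^sup>L (\<mu> j) (v j))"
proof -
  have [measurable]: "v j \<in> borel_measurable borel" for j
    using borel_measurable_integrable[OF assms, of j] by (simp cong: measurable_cong_sets add: sets_marginal)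
  show "integrable (prod_law \<mu>) (\<lambda>x. \<Prod>j\<in>UNIV. v j (x $ j))"
    unfolding prod_law_def
    by (subst integrable_distr_eq) (simp_all add: product_integrable_prod assms)
  show "(\<integral>x. (\<Prod>j\<in>UNIV. v j (x $ j)) \<partial>prod_law \<mu>) = (\<Prod>j\<in>UNIV. integral\<^sup>L (\<mu> j) (v j))"
    unfolding prod_law_def
    by (subst integral_distr) (simp_all add: product_integral_prod assms)
qed

lemma
  fixes g :: "_ \<Rightarrow> 'b::{banach, second_countable_topology}"
  assumes int: "integrable (prod_law \<mu>) g" and eq: "\<And>x. x \<in> box_of \<Omega> \<Longrightarrow> g' x = g x"
  shows set_integrable_box: "set_integrable (prod_law \<mu>) (box_of \<Omega>) g'"
    and set_integral_box_eq: "(LINT x:box_of \<Omega>|prod_law \<mu>. g' x) = (\<integral>x. g x \<partial>prod_law \<mu>)"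
proof -
  have box: "box_of \<Omega> \<in> sets (prod_law \<mu>)" by (simp add: sets_prod_law)
  have gg: "indicator (box_of \<Omega>) x *\<^sub>R g' x = indicator (box_of \<Omega>) x *\<^sub>R g x" for x
    using eq by (auto simp: indicator_def)
  show "set_integrable (prod_law \<mu>) (box_of \<Omega>) g'"
    unfolding set_integrable_def gg by (rule integrable_mult_indicator[OF box int])
  show "(LINT x:box_of \<Omega>|prod_law \<mu>. g' x) = (\<integral>x. g x \<partial>prod_law \<mu>)"
    unfolding set_lebesgue_integral_def gg
    using box borel_measurable_integrable[OF int] AE_in_box
    by (intro integral_cong_AE) (auto elim!: eventually_mono intro: borel_measurable_scaleR borel_measurable_indicator)
qed

text \<open>
  Every entry of \<open>outer (h x) (h x)\<close>, and on the box every entry of \<open>deriv_outer \<mu> \<rho> u h x\<close>, is a product of functions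
  of one coordinate each, and so the integrals factor. In the second case the squared density that arises
  from differentiating \<open>F\<^sub>j\<close> cancels against the weight. The mean vanishes because some factor with index in the
  nonempty set \<open>u\<close> has mean zero.
\<close>

lemma extremal_properties:
  fixes a b :: "'d \<Rightarrow> real ^ 'n"
  assumes "u \<noteq> {}"
  defines "h \<equiv> extremal \<mu> u a b"
  shows "differentiable_wrt (box_of \<Omega>) u h"
    and "set_integrable (prod_law \<mu>) (box_of \<Omega>) h"
    and "set_integrable (prod_law \<mu>) (box_of \<Omega>) (\<lambda>x. outer (h x) (h x))"
    and "set_integrable (prod_law \<mu>) (box_of \<Omega>) (deriv_outer \<mu> \<rho> u h)"
    and "var_matrix (prod_law \<mu>) (box_of \<Omega>) h =
      (1 / 2 ^ card u) *\<^sub>R (LINT x:box_of \<Omega>|prod_law \<mu>. deriv_outer \<mu> \<rho> u h x)"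
proof -
  let ?F = "\<lambda>j. cdf (\<mu> j)"
  define \<phi> where "\<phi> j t = (if j \<in> u then ?F j t *\<^sub>R a j - (1 / 2) *\<^sub>R a j else ?F j t *\<^sub>R a j + b j)" for j t
  \<comment> \<open>\<open>\<phi> j\<close> is the \<open>j\<close>th factor of \<open>h\<close>, and \<open>v p q j\<close> the \<open>j\<close>th factor of the \<open>(p, q)\<close> entry of the weighted
    outer product of derivatives.\<close>
  define v where "v p q j t = (if j \<in> u then ?F j t * (1 - ?F j t) * (a j $ p * a j $ q)
      else \<phi> j t $ p * \<phi> j t $ q)" for p q j t
  have h: "h = (\<lambda>x. \<Prod>j\<in>UNIV. \<phi> j (x $ j))"
  proof
    fix x
    have "(\<Prod>j\<in>UNIV. \<phi> j (x $ j)) = (\<Prod>j\<in>- u. \<phi> j (x $ j)) * (\<Prod>j\<in>u. \<phi> j (x $ j))"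
      by (subst prod.union_disjoint[symmetric]) (auto intro!: prod.cong)
    also have "\<dots> = h x"
      by (simp add: h_def extremal_def \<phi>_def)
    finally show "h x = (\<Prod>j\<in>UNIV. \<phi> j (x $ j))" ..
  qed
  have \<phi>_deriv: "(\<phi> j has_vector_derivative \<rho> j t *\<^sub>R a j) (at t)" if "j \<in> u" "t \<in> \<Omega> j" for j t
    using that cdf_has_vector_derivative[OF that(2)]
    by (auto simp: \<phi>_def[abs_def] intro!: derivative_eq_intros simp: has_real_derivative_iff_has_vector_derivative)
  note partial = iter_partial_prod[of \<Omega> "sorted_list_of_set u" \<phi> "\<lambda>j t. \<rho> j t *\<^sub>R a j", OF open_support]
  show "differentiable_wrt (box_of \<Omega>) u h"
    unfolding differentiable_wrt_def h using partial \<phi>_deriv by simp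
  have cross: "cross_partial u h x = (\<Prod>j\<in>UNIV. (if j \<in> u then \<lambda>t. \<rho> j t *\<^sub>R a j else \<phi> j) (x $ j))"
    if "x \<in> box_of \<Omega>" for x
    unfolding cross_partial_def h using partial \<phi>_deriv that by simp
  have int_F: "integrable (\<mu> j) (?F j)" "integrable (\<mu> j) (\<lambda>t. (?F j t)\<^sup>2)" for j
  proof -
    interpret real_distribution "\<mu> j" by (rule real_distribution)
    show "integrable (\<mu> j) (?F j)" "integrable (\<mu> j) (\<lambda>t. (?F j t)\<^sup>2)"
      by (rule integrable_bounded[where B=1]; simp add: abs_cdf_le_1 power_le_one cdf_nonneg cdf_bounded_prob)+
  qed
  have int_const: "integrable (\<mu> j) (\<lambda>t. c :: real)" for j c
    using prob_space_marginal[of j] by (simp add: prob_space.finite_measure finite_measure.integrable_const)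
  have mass: "measure (\<mu> j) (space (\<mu> j)) = 1" for j
    by (rule prob_space.prob_space[OF prob_space_marginal])
  have E_F: "(\<integral>t. ?F j t \<partial>\<mu> j) = 1 / 2" "(\<integral>t. (?F j t)\<^sup>2 \<partial>\<mu> j) = 1 / 3" for j
    by (rule real_distribution.integral_cdf[OF real_distribution no_atom]
          real_distribution.integral_cdf_squared[OF real_distribution no_atom])+
  have \<phi>_comp: "\<phi> j t $ p = ?F j t * a j $ p + (if j \<in> u then - (a j $ p) / 2 else b j $ p)" for j t p
    by (simp add: \<phi>_def)
  have int_\<phi>: "integrable (\<mu> j) (\<lambda>t. \<phi> j t $ p)" for j p
    unfolding \<phi>_comp by (intro Bochner_Integration.integrable_add integrable_mult_left int_F int_const)
  have quadratic: "integrable (\<mu> j) (\<lambda>t. k * (?F j t)\<^sup>2 + l * ?F j t + m)"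
      "(\<integral>t. k * (?F j t)\<^sup>2 + l * ?F j t + m \<partial>\<mu> j) = k / 3 + l / 2 + m" for j m l k
    using int_F[of j] int_const[of j] by (simp_all add: E_F mass)
  have \<phi>_prod: "\<phi> j t $ p * \<phi> j t $ q = (a j $ p * a j $ q) * (?F j t)\<^sup>2
      + (a j $ p * (if j \<in> u then - (a j $ q) / 2 else b j $ q) + a j $ q * (if j \<in> u then - (a j $ p) / 2 else b j $ p)) * ?F j t
      + (if j \<in> u then - (a j $ p) / 2 else b j $ p) * (if j \<in> u then - (a j $ q) / 2 else b j $ q)" for j t p q
    unfolding \<phi>_comp by (simp add: power2_eq_square algebra_simps)
  have int_\<phi>\<phi>: "integrable (\<mu> j) (\<lambda>t. \<phi> j t $ p * \<phi> j t $ q)" for j p q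
    unfolding \<phi>_prod by (rule quadratic)
  have v_prod: "v p q j t = - (a j $ p * a j $ q) * (?F j t)\<^sup>2 + (a j $ p * a j $ q) * ?F j t + 0"
    if "j \<in> u" for p q j t
    using that by (simp add: v_def power2_eq_square algebra_simps)
  have int_v: "integrable (\<mu> j) (v p q j)" for p q j
  proof (cases "j \<in> u")
    case True
    show ?thesis
      unfolding v_prod[OF True, abs_def] by (rule quadratic)
  next
    case False
    then show ?thesis using int_\<phi>\<phi> by (simp add: v_def[abs_def])
  qed
  \<comment> \<open>For \<open>j \<in> u\<close> this compares \<open>1/12\<close> with \<open>1/6\<close>, both times the product of the two components of \<open>a j\<close>.\<close>
  have E_\<phi>\<phi>: "(\<integral>t. \<phi> j t $ p * \<phi> j t $ q \<partial>\<mu> j) = (if j \<in> u then 1 / 2 else 1) * (\<integral>t. v p q j t \<partial>\<mu> j)" for j p q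
  proof (cases "j \<in> u")
    case True
    then show ?thesis
      unfolding \<phi>_prod v_prod[OF True] quadratic(2) by (simp add: field_simps)
  next
    case False
    then show ?thesis by (simp add: v_def)
  qed
  have h_comp: "h x $ p = (\<Prod>j\<in>UNIV. \<phi> j (x $ j) $ p)" for x p
    by (simp add: h prod_component)
  have int_h: "integrable (prod_law \<mu>) h"
    by (rule integrable_vecI) (simp add: h_comp integrable_prod_law_prod[OF int_\<phi>])
  show "set_integrable (prod_law \<mu>) (box_of \<Omega>) h"
    by (rule set_integrable_box[OF int_h refl])
  have hh_comp: "outer (h x) (h x) $ p $ q = (\<Prod>j\<in>UNIV. \<phi> j (x $ j) $ p * \<phi> j (x $ j) $ q)" for x p q
    by (simp add: outer_component h_comp prod.distrib)
  have int_hh_row: "integrable (prod_law \<mu>) (\<lambda>x. outer (h x) (h x) $ p)" for p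
    by (rule integrable_vecI) (simp add: hh_comp integrable_prod_law_prod[OF int_\<phi>\<phi>])
  then have int_hh: "integrable (prod_law \<mu>) (\<lambda>x. outer (h x) (h x))"
    by (rule integrable_vecI)
  show "set_integrable (prod_law \<mu>) (box_of \<Omega>) (\<lambda>x. outer (h x) (h x))"
    by (rule set_integrable_box[OF int_hh refl])
  define D where "D x = (\<chi> p q. \<Prod>j\<in>UNIV. v p q j (x $ j))" for x :: "(real, 'd) vec"
  have D_comp: "D x $ p $ q = (\<Prod>j\<in>UNIV. v p q j (x $ j))" for x p q
    by (simp add: D_def)
  have int_D_row: "integrable (prod_law \<mu>) (\<lambda>x. D x $ p)" for p
    by (rule integrable_vecI) (simp add: D_comp integrable_prod_law_prod[OF int_v])
  then have int_D: "integrable (prod_law \<mu>) D"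
    by (rule integrable_vecI)
  have D: "deriv_outer \<mu> \<rho> u h x = D x" if x: "x \<in> box_of \<Omega>" for x
  proof -
    have "deriv_outer \<mu> \<rho> u h x $ p $ q = D x $ p $ q" for p q
    proof -
      let ?w = "\<lambda>j. if j \<in> u then ?F j (x $ j) * (1 - ?F j (x $ j)) / (\<rho> j (x $ j))\<^sup>2 else 1"
      let ?\<psi> = "\<lambda>j. (if j \<in> u then \<lambda>t. \<rho> j t *\<^sub>R a j else \<phi> j) (x $ j)"
      have "weight \<mu> \<rho> u x = (\<Prod>j\<in>UNIV. ?w j)"
        unfolding weight_def by (subst prod.inter_restrict[symmetric]) (auto simp: prod.If_cases)
      then have "deriv_outer \<mu> \<rho> u h x $ p $ q = (\<Prod>j\<in>UNIV. ?w j * (?\<psi> j $ p * ?\<psi> j $ q))"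
        by (simp add: deriv_outer_def outer_component cross[OF x] prod_component prod.distrib)
      also have "\<dots> = (\<Prod>j\<in>UNIV. v p q j (x $ j))"
      proof (rule prod.cong[OF refl])
        fix j
        have "\<rho> j (x $ j) \<noteq> 0" using density_pos[of "x $ j" j] x by (auto simp: box_of_def)
        then show "?w j * (?\<psi> j $ p * ?\<psi> j $ q) = v p q j (x $ j)"
          by (simp add: v_def power2_eq_square)
      qed
      finally show ?thesis by (simp add: D_comp)
    qed
    then show ?thesis by (simp add: vec_eq_iff)
  qed
  show "set_integrable (prod_law \<mu>) (box_of \<Omega>) (deriv_outer \<mu> \<rho> u h)"
    by (rule set_integrable_box[OF int_D D])
  have E_h: "(\<integral>x. h x \<partial>prod_law \<mu>) = 0"
  proof -
    obtain i where i: "i \<in> u" using \<open>u \<noteq> {}\<close> by blast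
    have "(\<integral>x. h x \<partial>prod_law \<mu>) $ p = 0" for p
    proof -
      have "(\<integral>x. h x \<partial>prod_law \<mu>) $ p = (\<Prod>j\<in>UNIV. \<integral>t. \<phi> j t $ p \<partial>\<mu> j)"
        by (simp add: integral_component[OF int_h] h_comp integral_prod_law_prod[OF int_\<phi>])
      moreover have "(\<integral>t. \<phi> i t $ p \<partial>\<mu> i) = 0"
        using int_F[of i] int_const[of i] i by (simp add: \<phi>_comp E_F mass)
      then have "(\<Prod>j\<in>UNIV. \<integral>t. \<phi> j t $ p \<partial>\<mu> j) = 0"
        by (intro prod_zero) auto
      ultimately show ?thesis by simp
    qed
    then show ?thesis by (simp add: vec_eq_iff)
  qed
  have "(\<integral>x. outer (h x) (h x) \<partial>prod_law \<mu>) = (1 / 2 ^ card u) *\<^sub>R (\<integral>x. D x \<partial>prod_law \<mu>)"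
  proof -
    have "(\<integral>x. outer (h x) (h x) \<partial>prod_law \<mu>) $ p $ q = (1 / 2 ^ card u) * (\<integral>x. D x \<partial>prod_law \<mu>) $ p $ q" for p q
    proof -
      have "(\<integral>x. outer (h x) (h x) \<partial>prod_law \<mu>) $ p $ q = (\<Prod>j\<in>UNIV. \<integral>t. \<phi> j t $ p * \<phi> j t $ q \<partial>\<mu> j)"
        by (simp add: integral_component[OF int_hh] integral_component[OF int_hh_row] hh_comp
            integral_prod_law_prod[OF int_\<phi>\<phi>])
      also have "\<dots> = (\<Prod>j\<in>UNIV. if j \<in> u then 1 / 2 else 1) * (\<Prod>j\<in>UNIV. \<integral>t. v p q j t \<partial>\<mu> j)"
        by (simp add: E_\<phi>\<phi> prod.distrib)
      also have "(\<Prod>j\<in>UNIV. if j \<in> u then 1 / 2 else 1 :: real) = 1 / 2 ^ card u"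
        by (simp add: prod.If_cases power_divide)
      also have "(\<Prod>j\<in>UNIV. \<integral>t. v p q j t \<partial>\<mu> j) = (\<integral>x. D x \<partial>prod_law \<mu>) $ p $ q"
        by (simp add: integral_component[OF int_D] integral_component[OF int_D_row] D_comp
            integral_prod_law_prod[OF int_v])
      finally show ?thesis .
    qed
    then show ?thesis by (simp add: vec_eq_iff)
  qed
  moreover have "outer 0 0 = (0 :: real ^ 'n ^ 'n)"
    by (simp add: vec_eq_iff outer_component)
  ultimately show "var_matrix (prod_law \<mu>) (box_of \<Omega>) h =
      (1 / 2 ^ card u) *\<^sub>R (LINT x:box_of \<Omega>|prod_law \<mu>. deriv_outer \<mu> \<rho> u h x)"
    by (simp add: var_matrix_def set_integral_box_eq[OF int_h refl] set_integral_box_eq[OF int_hh refl]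
        set_integral_box_eq[OF int_D D] E_h)
qed

end

section \<open>From the second moment to the matrix inequality\<close>

text \<open>
  The mean minimises the second moment about a point. The integral on the left is meaningful even if \<open>Y\<close> is
  not integrable, and then the right-hand side is infinite for every \<open>c\<close>.
\<close>

lemma (in prob_space) nn_integral_variance_le:
  fixes Y :: "'a \<Rightarrow> real"
  assumes [measurable]: "Y \<in> borel_measurable M"
  shows "(\<integral>\<^sup>+x. ennreal ((Y x - expectation Y)\<^sup>2) \<partial>M) \<le> (\<integral>\<^sup>+x. ennreal ((Y x - c)\<^sup>2) \<partial>M)"
    and "(\<integral>\<^sup>+x. ennreal ((Y x - c)\<^sup>2) \<partial>M) < \<infinity> \<Longrightarrow> integrable M Y \<and> integrable M (\<lambda>x. (Y x)\<^sup>2)"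
proof -
  have L2: "integrable M Y \<and> integrable M (\<lambda>x. (Y x)\<^sup>2) \<and> integrable M (\<lambda>x. (Y x - c)\<^sup>2)"
    if fin: "(\<integral>\<^sup>+x. ennreal ((Y x - c)\<^sup>2) \<partial>M) < \<infinity>"
  proof -
    have sq: "integrable M (\<lambda>x. (Y x - c)\<^sup>2)"
      using fin by (intro integrableI_bounded) simp_all
    have i: "integrable M (\<lambda>x. Y x - c)"
      by (rule square_integrable_imp_integrable[OF _ sq]) measurable
    have Y: "integrable M Y"
      using Bochner_Integration.integrable_add[OF i integrable_const[of c]] by simp
    have "(\<lambda>x. (Y x)\<^sup>2) = (\<lambda>x. (Y x - c)\<^sup>2 + 2 * c * Y x - c\<^sup>2)"
      by (simp add: fun_eq_iff power2_eq_square algebra_simps)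
    moreover have "integrable M (\<lambda>x. (Y x - c)\<^sup>2 + 2 * c * Y x - c\<^sup>2)"
      using sq Y by simp
    ultimately show ?thesis using sq Y by simp
  qed
  then show "(\<integral>\<^sup>+x. ennreal ((Y x - c)\<^sup>2) \<partial>M) < \<infinity> \<Longrightarrow> integrable M Y \<and> integrable M (\<lambda>x. (Y x)\<^sup>2)"
    by blast
  show "(\<integral>\<^sup>+x. ennreal ((Y x - expectation Y)\<^sup>2) \<partial>M) \<le> (\<integral>\<^sup>+x. ennreal ((Y x - c)\<^sup>2) \<partial>M)"
  proof (cases "(\<integral>\<^sup>+x. ennreal ((Y x - c)\<^sup>2) \<partial>M) < \<infinity>")
    case True
    note L2 = L2[OF True]
    have quad: "integrable M (\<lambda>x. (Y x - m)\<^sup>2)"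
        "expectation (\<lambda>x. (Y x - m)\<^sup>2) = expectation (\<lambda>x. (Y x)\<^sup>2) - 2 * m * expectation Y + m\<^sup>2" for m
    proof -
      have eq: "(\<lambda>x. (Y x - m)\<^sup>2) = (\<lambda>x. (Y x)\<^sup>2 - 2 * m * Y x + m\<^sup>2)"
        by (simp add: fun_eq_iff power2_eq_square algebra_simps)
      show "integrable M (\<lambda>x. (Y x - m)\<^sup>2)"
        "expectation (\<lambda>x. (Y x - m)\<^sup>2) = expectation (\<lambda>x. (Y x)\<^sup>2) - 2 * m * expectation Y + m\<^sup>2"
        unfolding eq using L2 by (simp_all add: prob_space)
    qed
    have "0 \<le> (expectation Y - c)\<^sup>2" by simp
    then have "expectation (\<lambda>x. (Y x - expectation Y)\<^sup>2) \<le> expectation (\<lambda>x. (Y x - c)\<^sup>2)"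
      unfolding quad(2) by (simp add: power2_eq_square algebra_simps)
    then show ?thesis
      by (simp add: nn_integral_eq_integral quad(1) ennreal_leI)
  next
    case False
    then show ?thesis by (simp add: less_top[symmetric])
  qed
qed

lemma bounded_linear_quadratic_form:
  "bounded_linear (\<lambda>A :: real ^ 'n ^ 'n. z \<bullet> (A *v z))"
  by (rule linear_conv_bounded_linear[THEN iffD1], rule linearI)
     (simp_all add: matrix_vector_mult_add_rdistrib inner_add_right scaleR_matrix_vector_assoc[symmetric])

lemma quadratic_form_outer: "z \<bullet> (outer a a *v z) = (z \<bullet> a)\<^sup>2"
proof -
  have "outer a a *v z = (a \<bullet> z) *\<^sub>R a"
    by (simp add: vec_eq_iff matrix_vector_mult_def outer_component inner_vec_def sum_distrib_left mult_ac)
  then show ?thesis by (simp add: power2_eq_square inner_commute)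
qed

context regular_marginals
begin

text \<open>
  The constant \<open>\<alpha>\<close> of the representation takes the place of the mean, which costs nothing by
  \<open>nn_integral_variance_le\<close>. The function \<open>h\<close> is controlled on the box only, so it is cut off outside; the
  box carries the whole mass, and the cut-off changes no integral.
\<close>

lemma variance_bound:
  fixes f h :: "(real, 'd) vec \<Rightarrow> real ^ 'n"
  assumes f [measurable]: "cross_partial u f \<in> borel_measurable borel"
    and "associated \<mu> \<rho> \<Omega> u f h"
    and cross: "\<And>x. x \<in> box_of \<Omega> \<Longrightarrow> cross_partial u h x = cross_partial u f x"
  defines "M \<equiv> prod_law \<mu>" and "V \<equiv> box_of \<Omega>"
  shows "(\<integral>\<^sup>+x\<in>V. ennreal ((z \<bullet> h x - (LINT y:V|M. z \<bullet> h y))\<^sup>2) \<partial>M)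
      \<le> ennreal (1 / 2 ^ card u) * (\<integral>\<^sup>+x\<in>V. ennreal ((z \<bullet> cross_partial u h x)\<^sup>2 * weight \<mu> \<rho> u x) \<partial>M)"
    and "ennreal (1 / 2 ^ card u) * (\<integral>\<^sup>+x\<in>V. ennreal ((z \<bullet> cross_partial u h x)\<^sup>2 * weight \<mu> \<rho> u x) \<partial>M) < \<infinity> \<Longrightarrow> set_integrable M V (\<lambda>x. z \<bullet> h x) \<and> set_integrable M V (\<lambda>x. (z \<bullet> h x)\<^sup>2)"
proof -
  let ?r = "\<lambda>x. LINT y:PiE u \<Omega>|PiM u \<mu>. repr_integrand \<mu> \<rho> u f x y"
  let ?var = "\<integral>\<^sup>+x\<in>V. ennreal ((z \<bullet> h x - (LINT y:V|M. z \<bullet> h y))\<^sup>2) \<partial>M"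
  let ?bound = "ennreal (1 / 2 ^ card u) * (\<integral>\<^sup>+x\<in>V. ennreal ((z \<bullet> cross_partial u h x)\<^sup>2 * weight \<mu> \<rho> u x) \<partial>M)"
  interpret L: prob_space M unfolding M_def by (rule prob_space_prod_law)
  have V [measurable]: "V \<in> sets borel" unfolding V_def by measurable
  have sets_M [measurable_cong]: "sets M = sets borel" by (simp add: M_def sets_prod_law)
  obtain s \<alpha> where s: "s \<in> {1, - 1}" and
    int: "\<And>x. x \<in> V \<Longrightarrow> set_integrable (PiM u \<mu>) (PiE u \<Omega>) (repr_integrand \<mu> \<rho> u f x)" and
    h: "\<And>x. x \<in> V \<Longrightarrow> h x = s *\<^sub>R ?r x + \<alpha>"
    using assms(2) unfolding associated_def V_def by blast
  define Y where "Y x = indicator V x * (z \<bullet> h x)" for x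
  have Y_eq: "Y = (\<lambda>x. indicator V x * (z \<bullet> (s *\<^sub>R ?r x + \<alpha>)))"
    by (auto simp: fun_eq_iff Y_def indicator_def h)
  have [measurable]: "Y \<in> borel_measurable M"
    unfolding Y_eq by measurable
  have AE_V: "AE x in M. x \<in> V" unfolding M_def V_def by (rule AE_in_box)
  have "(\<integral>\<^sup>+x. ennreal ((Y x - z \<bullet> \<alpha>)\<^sup>2) \<partial>M) = (\<integral>\<^sup>+x\<in>V. ennreal ((z \<bullet> ?r x)\<^sup>2) \<partial>M)"
  proof (rule nn_integral_cong_AE, use AE_V in eventually_elim)
    case (elim x)
    have "(Y x - z \<bullet> \<alpha>)\<^sup>2 = (s * (z \<bullet> ?r x))\<^sup>2" using elim by (simp add: Y_def h inner_add_right)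
    also have "\<dots> = (z \<bullet> ?r x)\<^sup>2" using s by auto
    finally show ?case using elim by simp
  qed
  also have "\<dots> \<le> ennreal (1 / 2 ^ card u) *
      (\<integral>\<^sup>+x\<in>V. ennreal ((z \<bullet> cross_partial u f x)\<^sup>2 * weight \<mu> \<rho> u x) \<partial>M)"
    unfolding M_def V_def using int by (intro repr_integral_bound) (simp_all add: V_def)
  also have "(\<integral>\<^sup>+x\<in>V. ennreal ((z \<bullet> cross_partial u f x)\<^sup>2 * weight \<mu> \<rho> u x) \<partial>M)
      = (\<integral>\<^sup>+x\<in>V. ennreal ((z \<bullet> cross_partial u h x)\<^sup>2 * weight \<mu> \<rho> u x) \<partial>M)"
    by (intro nn_integral_cong) (auto simp: indicator_def cross V_def)
  finally have bound: "(\<integral>\<^sup>+x. ennreal ((Y x - z \<bullet> \<alpha>)\<^sup>2) \<partial>M) \<le> ?bound" .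
  have EY: "L.expectation Y = (LINT y:V|M. z \<bullet> h y)"
    by (simp add: set_lebesgue_integral_def Y_def[abs_def])
  have "?var = (\<integral>\<^sup>+x. ennreal ((Y x - L.expectation Y)\<^sup>2) \<partial>M)"
    by (rule nn_integral_cong_AE, use AE_V in eventually_elim) (simp add: EY Y_def)
  also have "\<dots> \<le> (\<integral>\<^sup>+x. ennreal ((Y x - z \<bullet> \<alpha>)\<^sup>2) \<partial>M)"
    by (rule L.nn_integral_variance_le) measurable
  finally show "?var \<le> ?bound" using bound by (rule order_trans)
  assume "?bound < \<infinity>"
  then have "integrable M Y \<and> integrable M (\<lambda>x. (Y x)\<^sup>2)"
    by (intro L.nn_integral_variance_le(2)[where c="z \<bullet> \<alpha>"] order_le_less_trans[OF bound]) auto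
  moreover have "Y = (\<lambda>x. indicator V x *\<^sub>R (z \<bullet> h x))"
      "(\<lambda>x. (Y x)\<^sup>2) = (\<lambda>x. indicator V x *\<^sub>R (z \<bullet> h x)\<^sup>2)"
    by (simp_all add: fun_eq_iff Y_def indicator_def)
  ultimately show "set_integrable M V (\<lambda>x. z \<bullet> h x) \<and> set_integrable M V (\<lambda>x. (z \<bullet> h x)\<^sup>2)"
    by (simp only: set_integrable_def)
qed

text \<open>
  Every quantity is tested against \<open>A \<mapsto> z \<bullet> (A *v z)\<close>, a bounded linear functional that commutes with the
  integral and maps \<open>outer a a\<close> to \<open>(z \<bullet> a)\<^sup>2\<close>. Integrability of the derivative matrix makes the right-hand side of
  the scalar inequality finite for every \<open>z\<close>; hence every \<open>z \<bullet> h\<close> is square integrable.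
\<close>

lemma loewner_bound:
  fixes f h :: "(real, 'd) vec \<Rightarrow> real ^ 'n"
  assumes f: "cross_partial u f \<in> borel_measurable borel"
    and ass: "associated \<mu> \<rho> \<Omega> u f h"
    and cross: "\<And>x. x \<in> box_of \<Omega> \<Longrightarrow> cross_partial u h x = cross_partial u f x"
    and int: "set_integrable (prod_law \<mu>) (box_of \<Omega>) (deriv_outer \<mu> \<rho> u h)"
  shows "set_integrable (prod_law \<mu>) (box_of \<Omega>) h"
    and "set_integrable (prod_law \<mu>) (box_of \<Omega>) (\<lambda>x. outer (h x) (h x))"
    and "var_matrix (prod_law \<mu>) (box_of \<Omega>) h \<preceq>\<^sub>L
      (1 / 2 ^ card u) *\<^sub>R (LINT x:box_of \<Omega>|prod_law \<mu>. deriv_outer \<mu> \<rho> u h x)"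
proof -
  let ?M = "prod_law \<mu>" and ?V = "box_of \<Omega>"
  let ?q = "\<lambda>z x. (z \<bullet> cross_partial u h x)\<^sup>2 * weight \<mu> \<rho> u x"
  interpret L: prob_space ?M by (rule prob_space_prod_law)
  have V [measurable]: "?V \<in> sets ?M" by (simp add: sets_prod_law)
  have weight_nonneg: "0 \<le> weight \<mu> \<rho> u x" for x
    unfolding weight_def using real_distribution.cdf_bounded_prob[OF real_distribution]
    by (intro prod_nonneg divide_nonneg_nonneg mult_nonneg_nonneg) (simp_all add: cdf_def)
  have q_outer: "z \<bullet> ((indicator ?V x *\<^sub>R deriv_outer \<mu> \<rho> u h x) *v z) = indicator ?V x * ?q z x" for z x
    by (simp add: deriv_outer_def quadratic_form_outer scaleR_matrix_vector_assoc[symmetric] mult.commute)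
  have int_q: "integrable ?M (\<lambda>x. indicator ?V x * ?q z x)" for z
    using integrable_bounded_linear[OF bounded_linear_quadratic_form int[unfolded set_integrable_def], of z]
    by (simp only: q_outer)
  have E_q: "z \<bullet> ((LINT x:?V|?M. deriv_outer \<mu> \<rho> u h x) *v z) = (\<integral>x. indicator ?V x * ?q z x \<partial>?M)" for z
    using integral_bounded_linear[OF bounded_linear_quadratic_form int[unfolded set_integrable_def], of z]
    by (simp only: q_outer set_lebesgue_integral_def)
  have nn_q: "(\<integral>\<^sup>+x\<in>?V. ennreal (?q z x) \<partial>?M) = ennreal (\<integral>x. indicator ?V x * ?q z x \<partial>?M)" for z
  proof -
    have "(\<integral>\<^sup>+x\<in>?V. ennreal (?q z x) \<partial>?M) = (\<integral>\<^sup>+x. ennreal (indicator ?V x * ?q z x) \<partial>?M)"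
      by (intro nn_integral_cong) (simp add: indicator_def)
    also have "\<dots> = ennreal (\<integral>x. indicator ?V x * ?q z x \<partial>?M)"
      by (rule nn_integral_eq_integral[OF int_q]) (simp add: weight_nonneg)
    finally show ?thesis .
  qed
  note bound = variance_bound[OF f ass cross]
  have L2: "integrable ?M (\<lambda>x. indicator ?V x * (z \<bullet> h x))" "integrable ?M (\<lambda>x. indicator ?V x * (z \<bullet> h x)\<^sup>2)" for z
    using bound(2)[of z] by (simp_all add: nn_q ennreal_mult_less_top set_integrable_def)
  show int_h: "set_integrable ?M ?V h"
    unfolding set_integrable_def
  proof (rule integrable_vecI)
    fix i show "integrable ?M (\<lambda>x. (indicator ?V x *\<^sub>R h x) $ i)"
      using L2(1)[of "axis i 1"] by (simp add: inner_axis' inner_axis)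
  qed
  have int_outer_row: "integrable ?M (\<lambda>x. (indicator ?V x *\<^sub>R outer (h x) (h x)) $ i)" for i
  proof (rule integrable_vecI)
    fix j
    \<comment> \<open>Mixed products of components are recovered from squares by polarization.\<close>
    have "(indicator ?V x *\<^sub>R outer (h x) (h x)) $ i $ j = (indicator ?V x * ((axis i 1 + axis j 1) \<bullet> h x)\<^sup>2
        - indicator ?V x * (axis i 1 \<bullet> h x)\<^sup>2 - indicator ?V x * (axis j 1 \<bullet> h x)\<^sup>2) / 2" for x
      by (simp add: outer_component inner_axis' inner_add_left power2_eq_square algebra_simps)
    moreover have "integrable ?M (\<lambda>x. (indicator ?V x * ((axis i 1 + axis j 1) \<bullet> h x)\<^sup>2
        - indicator ?V x * (axis i 1 \<bullet> h x)\<^sup>2 - indicator ?V x * (axis j 1 \<bullet> h x)\<^sup>2) / 2)"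
      by (intro integrable_divide Bochner_Integration.integrable_diff L2(2))
    ultimately show "integrable ?M (\<lambda>x. (indicator ?V x *\<^sub>R outer (h x) (h x)) $ i $ j)"
      by (simp only:)
  qed
  then have int_outer: "integrable ?M (\<lambda>x. indicator ?V x *\<^sub>R outer (h x) (h x))"
    by (rule integrable_vecI)
  then show "set_integrable ?M ?V (\<lambda>x. outer (h x) (h x))"
    by (simp add: set_integrable_def)
  let ?D = "LINT x:?V|?M. deriv_outer \<mu> \<rho> u h x" and ?m = "LINT x:?V|?M. h x"
  let ?A = "(1 / 2 ^ card u) *\<^sub>R ?D - var_matrix ?M ?V h"
  have sym_integral: "transpose (\<integral>x. G x \<partial>?M) = (\<integral>x. G x \<partial>?M)"
    if int: "integrable ?M G" and sym: "\<And>x. transpose (G x) = G x" for G :: "_ \<Rightarrow> real ^ 'n ^ 'n"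
  proof -
    have "bounded_linear (transpose :: real ^ 'n ^ 'n \<Rightarrow> _)"
      by (rule linear_conv_bounded_linear[THEN iffD1], rule linearI) (simp_all add: transpose_def vec_eq_iff)
    then have "transpose (\<integral>x. G x \<partial>?M) = (\<integral>x. transpose (G x) \<partial>?M)"
      using int by (rule integral_bounded_linear[symmetric])
    then show ?thesis by (simp only: sym)
  qed
  have transpose_outer: "transpose (outer a a) = outer a a" for a :: "real ^ 'n"
    by (simp add: transpose_def vec_eq_iff outer_component mult.commute)
  have transpose_scaleR: "transpose (c *\<^sub>R B) = c *\<^sub>R transpose B" and transpose_diff: "transpose (B - C) = transpose B - transpose C"
    for c and B C :: "real ^ 'n ^ 'n"
    by (simp_all add: transpose_def vec_eq_iff)
  have "transpose ?D = ?D"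
    unfolding set_lebesgue_integral_def
    by (rule sym_integral[OF int[unfolded set_integrable_def]])
       (simp add: deriv_outer_def transpose_scaleR transpose_outer)
  moreover have "transpose (LINT x:?V|?M. outer (h x) (h x)) = (LINT x:?V|?M. outer (h x) (h x))"
    unfolding set_lebesgue_integral_def
    by (rule sym_integral[OF int_outer]) (simp add: transpose_scaleR transpose_outer)
  ultimately have "transpose ?A = ?A"
    by (simp add: var_matrix_def transpose_diff transpose_scaleR transpose_outer)
  moreover have "0 \<le> z \<bullet> (?A *v z)" for z
  proof -
    let ?c = "LINT y:?V|?M. z \<bullet> h y"
    have c: "z \<bullet> ?m = ?c"
      using integral_inner_right[of z ?M, OF int_h[unfolded set_integrable_def]]
      by (simp add: set_lebesgue_integral_def)
    have "z \<bullet> ((LINT x:?V|?M. outer (h x) (h x)) *v z) = (\<integral>x. indicator ?V x * (z \<bullet> h x)\<^sup>2 \<partial>?M)"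
      using integral_bounded_linear[OF bounded_linear_quadratic_form int_outer, of z]
      by (simp add: set_lebesgue_integral_def scaleR_matrix_vector_assoc[symmetric] quadratic_form_outer)
    then have quad_var: "z \<bullet> (var_matrix ?M ?V h *v z) = (\<integral>x. indicator ?V x * (z \<bullet> h x)\<^sup>2 \<partial>?M) - ?c\<^sup>2"
      by (simp add: var_matrix_def matrix_vector_mult_diff_rdistrib inner_diff_right quadratic_form_outer c)
    have sq: "indicator ?V x * (z \<bullet> h x - ?c)\<^sup>2 = indicator ?V x * (z \<bullet> h x)\<^sup>2 - 2 * ?c * (indicator ?V x * (z \<bullet> h x)) + ?c\<^sup>2 * indicator ?V x" for x
      by (simp add: power2_eq_square algebra_simps)
    have int_1: "integrable ?M (indicator ?V :: _ \<Rightarrow> real)"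
      by (intro L.integrable_const_bound[where B=1]) simp_all
    have meas_V: "(\<integral>x. indicator ?V x \<partial>?M) = (1 :: real)"
      using L.prob_eq_1[OF V] AE_in_box by simp
    have int_sq: "integrable ?M (\<lambda>x. indicator ?V x * (z \<bullet> h x - ?c)\<^sup>2)"
      unfolding sq using L2 int_1 by simp
    have "(\<integral>x. indicator ?V x * (z \<bullet> h x - ?c)\<^sup>2 \<partial>?M) = (\<integral>x. indicator ?V x * (z \<bullet> h x)\<^sup>2 \<partial>?M) - ?c\<^sup>2"
    proof -
      have "(\<integral>x. indicator ?V x * (z \<bullet> h x) \<partial>?M) = ?c" by (simp add: set_lebesgue_integral_def)
      then show ?thesis
        unfolding sq using L2 int_1 meas_V by (simp add: power2_eq_square)
    qed
    then have "ennreal (z \<bullet> (var_matrix ?M ?V h *v z)) = ennreal (\<integral>x. indicator ?V x * (z \<bullet> h x - ?c)\<^sup>2 \<partial>?M)"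
      by (simp add: quad_var)
    also have "\<dots> = (\<integral>\<^sup>+x. ennreal (indicator ?V x * (z \<bullet> h x - ?c)\<^sup>2) \<partial>?M)"
      by (rule nn_integral_eq_integral[OF int_sq, symmetric]) simp
    also have "\<dots> = (\<integral>\<^sup>+x\<in>?V. ennreal ((z \<bullet> h x - ?c)\<^sup>2) \<partial>?M)"
      by (intro nn_integral_cong) (simp add: indicator_def)
    also have "\<dots> \<le> ennreal (1 / 2 ^ card u) * (\<integral>\<^sup>+x\<in>?V. ennreal (?q z x) \<partial>?M)"
      by (rule bound(1))
    also have "\<dots> = ennreal ((1 / 2 ^ card u) * (z \<bullet> (?D *v z)))"
      by (simp add: nn_q E_q flip: ennreal_mult')
    finally have "z \<bullet> (var_matrix ?M ?V h *v z) \<le> (1 / 2 ^ card u) * (z \<bullet> (?D *v z))"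
      by (rule ennreal_le_iff[THEN iffD1, rotated])
         (auto simp: E_q weight_nonneg intro!: mult_nonneg_nonneg Bochner_Integration.integral_nonneg)
    then show ?thesis
      by (simp add: matrix_vector_mult_diff_rdistrib inner_diff_right scaleR_matrix_vector_assoc[symmetric])
  qed
  ultimately show "var_matrix ?M ?V h \<preceq>\<^sub>L (1 / 2 ^ card u) *\<^sub>R ?D"
    by (simp add: loewner_le_def psd_def)
qed

end

theorem theorem3p3:
  fixes P :: "'a measure"
    and X :: "'a \<Rightarrow> real ^ ('d::{finite,linorder})"
    and \<mu> :: "('d::{finite,linorder}) \<Rightarrow> real measure"
    and \<rho> :: "('d::{finite,linorder}) \<Rightarrow> real \<Rightarrow> real"
    and \<Omega> :: "('d::{finite,linorder}) \<Rightarrow> real set"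
    and u :: "('d::{finite,linorder}) set"
    and f h :: "real ^ ('d::{finite,linorder}) \<Rightarrow> real ^ 'n"
  assumes "prob_space P"
    and "prob_space.indep_vars P (\<lambda>_. borel) (\<lambda>j w. X w $ j) UNIV"
    and "\<And>j. distr P borel (\<lambda>w. X w $ j) = \<mu> j"
    and "\<And>j. regular_marginal (\<mu> j) (\<rho> j) (\<Omega> j)"
    and "u \<noteq> {}"
    and "f \<in> class_F P X"
    and "associated \<mu> \<rho> \<Omega> u f h"
    and "differentiable_wrt (box_of \<Omega>) u h"
    and "\<And>x. x \<in> box_of \<Omega> \<Longrightarrow> cross_partial u h x = cross_partial u f x"
  shows
    "(set_integrable (prod_law \<mu>) (box_of \<Omega>) (deriv_outer \<mu> \<rho> u h) \<longrightarrow>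
        set_integrable (prod_law \<mu>) (box_of \<Omega>) h \<and>
        set_integrable (prod_law \<mu>) (box_of \<Omega>) (\<lambda>x. outer (h x) (h x)) \<and>
        var_matrix (prod_law \<mu>) (box_of \<Omega>) h \<preceq>\<^sub>L
          (1 / 2 ^ card u) *\<^sub>R (LINT x:box_of \<Omega>|prod_law \<mu>. deriv_outer \<mu> \<rho> u h x)) \<and>
     (\<forall>z. (\<integral>\<^sup>+ x\<in>box_of \<Omega>. ennreal ((z \<bullet> h x - (LINT y:box_of \<Omega>|prod_law \<mu>. z \<bullet> h y))\<^sup>2)
             \<partial>prod_law \<mu>)
          \<le> ennreal (1 / 2 ^ card u) *
             (\<integral>\<^sup>+ x\<in>box_of \<Omega>. ennreal ((z \<bullet> cross_partial u h x)\<^sup>2 * weight \<mu> \<rho> u x)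
                \<partial>prod_law \<mu>)) \<and>
     (\<forall>a b. let h\<^sub>0 = (extremal \<mu> u a b :: real ^ ('d::{finite,linorder}) \<Rightarrow> real ^ 'n) in
        differentiable_wrt (box_of \<Omega>) u h\<^sub>0 \<and>
        set_integrable (prod_law \<mu>) (box_of \<Omega>) h\<^sub>0 \<and>
        set_integrable (prod_law \<mu>) (box_of \<Omega>) (\<lambda>x. outer (h\<^sub>0 x) (h\<^sub>0 x)) \<and>
        set_integrable (prod_law \<mu>) (box_of \<Omega>) (deriv_outer \<mu> \<rho> u h\<^sub>0) \<and>
        var_matrix (prod_law \<mu>) (box_of \<Omega>) h\<^sub>0 =
          (1 / 2 ^ card u) *\<^sub>R (LINT x:box_of \<Omega>|prod_law \<mu>. deriv_outer \<mu> \<rho> u h\<^sub>0 x))"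
proof -
  interpret regular_marginals \<mu> \<rho> \<Omega>
    using assms(4) by (rule regular_marginals.intro)
  have f: "cross_partial u f \<in> borel_measurable borel"
    using assms(6) by (simp add: class_F_def)
  show ?thesis
    unfolding Let_def
    by (intro conjI impI allI loewner_bound[OF f assms(7,9)] variance_bound(1)[OF f assms(7,9)]
        extremal_properties[OF assms(5)])
qed

end
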